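(* Let $\mathcal H\subset\mathcal H'$ be Hilbert spaces of dimensions $d$ and $d+1$ respectively, let $|\omega\rangle\in\mathcal H'$ be a unit vector orthogonal to $\mathcal H$, let $0\le\epsilon\le1$, and let $\Phi:\mathfrak S(\mathcal H)\to\mathfrak S(\mathcal H')$ be the erasure channel $\Phi(\sigma)=\epsilon|\omega\rangle\langle\omega|+(1-\epsilon)\sigma$. Let $\mathcal K$ be a finite-dimensional Hilbert space. Then for every quantum channel $\Omega:\mathfrak S(\mathcal K)\to\mathfrak S(\mathcal K)$ and every $\rho\in\mathfrak S(\mathcal H\otimes\mathcal K)$, $$H_{\Phi\otimes\Omega}(\rho)\ge H_\Phi(\mathrm{Tr}_{\mathcal K}(\rho))+H_\Omega(\mathrm{Tr}_{\mathcal H}(\rho)).$$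
   Context: $\mathfrak S(\cdot)$ denotes the set of density operators (and $\mathfrak S(\mathcal H)\subset\mathfrak S(\mathcal H')$ via the inclusion $\mathcal H\subset\mathcal H'$); a quantum channel is a completely positive trace-preserving linear map; $S(\sigma)=-\mathrm{Tr}(\sigma\log\sigma)$ is the von Neumann entropy. For a channel $\Psi$ with input space $\mathcal L$ and $\sigma\in\mathfrak S(\mathcal L)$, $H_\Psi(\sigma):=\min\sum_{j}\pi_jS(\Psi(\sigma_j))$, the minimum over all finite decompositions $\sigma=\sum_j\pi_j\sigma_j$ with $\{\pi_j\}$ a probability distribution and $\sigma_j\in\mathfrak S(\mathcal L)$. *)

theory Defs
  imports "Jordan_Normal_Form.Char_Poly" "HOL-Computational_Algebra.Polynomial"
begin

(* Finite-dimensional Hilbert spaces are C^n; operators are complex n x n matrices.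
   Composite index convention for C^n \<otimes> C^m: (x, a) \<mapsto> x * m + a. *)

definition mtrace :: "complex mat \<Rightarrow> complex" where
  "mtrace A = (\<Sum>i<dim_row A. A $$ (i, i))"

definition psd :: "nat \<Rightarrow> complex mat \<Rightarrow> bool" where
  "psd n A \<longleftrightarrow> A \<in> carrier_mat n n \<and>
     (\<forall>i<n. \<forall>j<n. A $$ (i, j) = cnj (A $$ (j, i))) \<and>
     (\<forall>v \<in> carrier_vec n.
        Im (\<Sum>i<n. \<Sum>j<n. cnj (v $ i) * A $$ (i, j) * v $ j) = 0 \<and>
        Re (\<Sum>i<n. \<Sum>j<n. cnj (v $ i) * A $$ (i, j) * v $ j) \<ge> 0)"

definition density :: "nat \<Rightarrow> complex mat \<Rightarrow> bool" where
  "density n A \<longleftrightarrow> psd n A \<and> mtrace A = 1"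

definition id_tensor :: "nat \<Rightarrow> nat \<Rightarrow> nat \<Rightarrow> (complex mat \<Rightarrow> complex mat) \<Rightarrow> complex mat \<Rightarrow> complex mat" where
  "id_tensor p n m \<Psi> X = mat (p * m) (p * m) (\<lambda>(r, s).
      \<Psi> (mat n n (\<lambda>(a, b). X $$ ((r div m) * n + a, (s div m) * n + b))) $$ (r mod m, s mod m))"

definition channel :: "nat \<Rightarrow> nat \<Rightarrow> (complex mat \<Rightarrow> complex mat) \<Rightarrow> bool" where
  "channel n m \<Psi> \<longleftrightarrow>
     (\<forall>A \<in> carrier_mat n n. \<Psi> A \<in> carrier_mat m m) \<and>
     (\<forall>A \<in> carrier_mat n n. \<forall>B \<in> carrier_mat n n. \<Psi> (A + B) = \<Psi> A + \<Psi> B) \<and>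
     (\<forall>A \<in> carrier_mat n n. \<forall>c. \<Psi> (c \<cdot>\<^sub>m A) = c \<cdot>\<^sub>m \<Psi> A) \<and>
     (\<forall>A \<in> carrier_mat n n. mtrace (\<Psi> A) = mtrace A) \<and>
     (\<forall>p X. psd (p * n) X \<longrightarrow> psd (p * m) (id_tensor p n m \<Psi> X))"

definition mat_unit :: "nat \<Rightarrow> nat \<Rightarrow> nat \<Rightarrow> complex mat" where
  "mat_unit n i j = mat n n (\<lambda>(x, y). if x = i \<and> y = j then 1 else 0)"

text \<open>Tensor product \<Phi> \<otimes> \<Omega> of maps (\<Phi> : d x d \<rightarrow> d' x d', \<Omega> : k x k \<rightarrow> k' x k'), defined by linearity.\<close>
definition chan_tensor :: "nat \<Rightarrow> nat \<Rightarrow> nat \<Rightarrow> nat \<Rightarrow> (complex mat \<Rightarrow> complex mat) \<Rightarrow>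
    (complex mat \<Rightarrow> complex mat) \<Rightarrow> complex mat \<Rightarrow> complex mat" where
  "chan_tensor d d' k k' \<Phi> \<Omega> X = mat (d' * k') (d' * k') (\<lambda>(r, s).
      \<Sum>i<d. \<Sum>j<d. \<Sum>a<k. \<Sum>b<k. X $$ (i * k + a, j * k + b) *
        \<Phi> (mat_unit d i j) $$ (r div k', s div k') * \<Omega> (mat_unit k a b) $$ (r mod k', s mod k'))"

definition ptrace_K :: "nat \<Rightarrow> nat \<Rightarrow> complex mat \<Rightarrow> complex mat" where
  "ptrace_K d k \<rho> = mat d d (\<lambda>(i, j). \<Sum>a<k. \<rho> $$ (i * k + a, j * k + a))"

definition ptrace_H :: "nat \<Rightarrow> nat \<Rightarrow> complex mat \<Rightarrow> complex mat" where
  "ptrace_H d k \<rho> = mat k k (\<lambda>(a, b). \<Sum>i<d. \<rho> $$ (i * k + a, i * k + b))"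

text \<open>von Neumann entropy via the eigenvalues (with algebraic multiplicity), 0 log 0 = 0.\<close>
definition eta :: "real \<Rightarrow> real" where
  "eta x = (if x \<le> 0 then 0 else x * ln x)"

definition vn_entropy :: "complex mat \<Rightarrow> real" where
  "vn_entropy A = - (\<Sum>z \<in># proots (char_poly A). eta (Re z))"

text \<open>H_\<Psi>(\<sigma>): minimum (infimum, attained) of average output entropy over finite
  convex decompositions of \<sigma> into density operators on C^n.\<close>
definition H_chan :: "nat \<Rightarrow> (complex mat \<Rightarrow> complex mat) \<Rightarrow> complex mat \<Rightarrow> real" where
  "H_chan n \<Psi> \<sigma> = Inf {(\<Sum>j<N. \<pi> j * vn_entropy (\<Psi> (\<sigma>s j))) | (N::nat) \<pi> \<sigma>s.
      (\<forall>j<N. 0 \<le> \<pi> j \<and> density n (\<sigma>s j)) \<and> (\<Sum>j<N. \<pi> j) = 1 \<and>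
      (\<forall>a<n. \<forall>b<n. \<sigma> $$ (a, b) = (\<Sum>j<N. complex_of_real (\<pi> j) * \<sigma>s j $$ (a, b)))}"

text \<open>Erasure channel C^d \<rightarrow> C^(d+1) (C^d embedded as the first d coordinates), linearly extended:
  \<Phi>(\<sigma>) = \<epsilon> Tr(\<sigma>) |\<omega>><\<omega>| + (1 - \<epsilon>) \<sigma>.\<close>
definition erasure :: "nat \<Rightarrow> real \<Rightarrow> complex vec \<Rightarrow> complex mat \<Rightarrow> complex mat" where
  "erasure d \<epsilon> \<omega> \<sigma> = mat (Suc d) (Suc d) (\<lambda>(i, j).
      complex_of_real \<epsilon> * mtrace \<sigma> * \<omega> $ i * cnj (\<omega> $ j) +
      complex_of_real (1 - \<epsilon>) * (if i < d \<and> j < d then \<sigma> $$ (i, j) else 0))"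

end

theory Submission
  imports Defs "Jordan_Normal_Form.Schur_Decomposition"
begin

text \<open>Write \<open>h = - eta \<epsilon> - eta (1 - \<epsilon>)\<close>. The output of \<open>\<Phi> \<otimes> \<Omega>\<close> is block diagonal, so its entropy on \<open>\<sigma>\<close> is
  \<open>h + \<epsilon> S(\<Omega>(Tr_H \<sigma>)) + (1 - \<epsilon>) S((id \<otimes> \<Omega>)(\<sigma>))\<close>, while \<open>H_\<Phi> \<le> h\<close> because pure inputs of the
  erasure channel have output entropy \<open>h\<close>. It remains to bound \<open>S((id \<otimes> \<Omega>)(\<sigma>))\<close> from below by an average
  of entropies \<open>S(\<Omega>(\<tau>_i))\<close> over a decomposition of \<open>Tr_H \<sigma>\<close>. The normalised diagonal blocks \<open>\<tau>_i\<close> of \<open>\<sigma>\<close>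
  form such a decomposition. Let \<open>B = (id \<otimes> \<Omega>)(\<sigma>)\<close>, a positive matrix by complete positivity, with
  diagonal blocks \<open>B_i = \<Omega>(\<sigma>_i)\<close>. Factor \<open>B = W W*\<close> and cut \<open>W\<close> into block rows \<open>W_i\<close>, so that
  \<open>B_i = W_i W_i*\<close>. Then \<open>S(B) = S(W* W)\<close> and \<open>W* W\<close> is the sum of the \<open>W_i* W_i\<close>, which have the nonzero
  spectra of the \<open>B_i\<close>; concavity of the entropy gives the bound. Neither Kraus operators nor
  purifications are needed.\<close>

section \<open>Spectral theorem for Hermitian matrices\<close>

definition dagger :: "complex mat \<Rightarrow> complex mat" where
  "dagger A = map_mat cnj (transpose_mat A)"

lemma dagger_carrier [simp]: "A \<in> carrier_mat n m \<Longrightarrow> dagger A \<in> carrier_mat m n"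
  by (simp add: dagger_def)

lemma dagger_dim [simp]: "dim_row (dagger A) = dim_col A" "dim_col (dagger A) = dim_row A"
  by (simp_all add: dagger_def)

lemma index_dagger [simp]:
  "i < dim_col A \<Longrightarrow> j < dim_row A \<Longrightarrow> dagger A $$ (i, j) = cnj (A $$ (j, i))"
  by (simp add: dagger_def)

lemma dagger_dagger [simp]: "dagger (dagger A) = A"
  by (rule eq_matI) auto

lemma dagger_mult:
  assumes "A \<in> carrier_mat n m" "B \<in> carrier_mat m p"
  shows "dagger (A * B) = dagger B * dagger A"
  by (rule eq_matI) (use assms in \<open>auto simp: scalar_prod_def mult.commute\<close>)

lemma index_mult_mat_sum:
  assumes "A \<in> carrier_mat n m" "B \<in> carrier_mat m p" "i < n" "j < p"
  shows "(A * B) $$ (i, j) = (\<Sum>x<m. A $$ (i, x) * B $$ (x, j))"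
  using assms by (auto simp: scalar_prod_def atLeast0LessThan)

text \<open>Complete \<open>v\<close> to a basis and apply Gram-Schmidt, which keeps the first
  vector; the scalar \<open>c\<close> absorbs its normalisation. This supplies the change of basis
  that splits off an eigenvector.\<close>

lemma ex_unitary_first_column:
  fixes v :: "complex vec"
  assumes v: "v \<in> carrier_vec n" and v0: "v \<noteq> 0\<^sub>v n" and n: "n \<noteq> 0"
  shows "\<exists>U c. U \<in> carrier_mat n n \<and> dagger U * U = 1\<^sub>m n \<and> col U 0 = c \<cdot>\<^sub>v v"
proof -
  interpret cof_vec_space n "TYPE(complex)" .
  define b where "b = basis_completion v"
  define ws where "ws = gram_schmidt n b"
  from basis_completion[OF v v0, folded b_def]
  have dist_b: "distinct b" and indep: "\<not> lin_dep (set b)" and b: "set b \<subseteq> carrier_vec n"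
    and hdb: "hd b = v" and len_b: "length b = n" by auto
  from hdb len_b n obtain vs where bv: "b = v # vs" by (cases b) auto
  from gram_schmidt_result[OF b dist_b indep refl, folded ws_def]
  have ws: "set ws \<subseteq> carrier_vec n" "corthogonal ws" "length ws = n"
    by (auto simp: len_b)
  have hdws: "ws ! 0 = v"
    using gram_schmidt_hd[OF v, of vs, folded bv] ws(3) n
    by (metis hd_conv_nth length_0_conv ws_def)
  \<comment> \<open>\<open>gram_schmidt\<close> orthogonalises without normalising.
    \<open>N j\<close> is the squared norm of the \<open>j\<close>-th vector, by whose root column
    \<open>j\<close> of \<open>U\<close> is divided.\<close>
  define N where "N j = (\<Sum>i<n. (cmod (ws ! j $ i))\<^sup>2)" for j
  have wsc: "ws ! j \<in> carrier_vec n" if "j < n" for j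
    using ws that by auto
  have ip: "ws ! j \<bullet>c ws ! l = (\<Sum>i<n. ws ! j $ i * cnj (ws ! l $ i))" if "j < n" "l < n" for j l
    using wsc[OF that(1)] wsc[OF that(2)] by (auto simp: scalar_prod_def atLeast0LessThan)
  have ipN: "(\<Sum>i<n. ws ! j $ i * cnj (ws ! j $ i)) = of_real (N j)" for j
    by (simp only: N_def complex_norm_square of_real_sum)
  have Npos: "N j > 0" if "j < n" for j
  proof -
    have "of_real (N j) \<noteq> (0::complex)"
      using corthogonalD[OF ws(2), of j j] ip[OF that that] ipN[of j] ws(3) that by auto
    moreover have "N j \<ge> 0" by (simp add: N_def sum_nonneg)
    ultimately show ?thesis by auto
  qed
  define U where "U = mat n n (\<lambda>(i, j). ws ! j $ i / of_real (sqrt (N j)))"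
  have U: "U \<in> carrier_mat n n" by (simp add: U_def)
  have "(dagger U * U) $$ (j, l) = 1\<^sub>m n $$ (j, l)" if jl: "j < n" "l < n" for j l
  proof -
    have "(dagger U * U) $$ (j, l) = (\<Sum>i<n. dagger U $$ (j, i) * U $$ (i, l))"
      using U jl by (intro index_mult_mat_sum) auto
    also have "\<dots> = (\<Sum>i<n. ws ! l $ i * cnj (ws ! j $ i) / (of_real (sqrt (N j)) * of_real (sqrt (N l))))"
      by (intro sum.cong refl) (use U jl in \<open>auto simp: U_def field_simps\<close>)
    also have "\<dots> = (\<Sum>i<n. ws ! l $ i * cnj (ws ! j $ i)) / (of_real (sqrt (N j)) * of_real (sqrt (N l)))"
      by (simp add: sum_divide_distrib)
    also have "\<dots> = (if j = l then 1 else 0)"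
    proof (cases "j = l")
      case True
      have "complex_of_real (sqrt (N l)) * of_real (sqrt (N l)) = of_real (N l)"
        using Npos[OF jl(2)] by (simp flip: of_real_mult)
      with True Npos[OF jl(2)] show ?thesis by (simp add: ipN)
    next
      case False
      with corthogonalD[OF ws(2), of l j] ip[OF jl(2,1)] ws(3) jl show ?thesis by simp
    qed
    finally show ?thesis using jl by simp
  qed
  then have "dagger U * U = 1\<^sub>m n"
    using U by (intro eq_matI) auto
  moreover have "col U 0 = (1 / of_real (sqrt (N 0))) \<cdot>\<^sub>v v"
    by (rule eq_vecI) (use U v n hdws in \<open>auto simp: U_def\<close>)
  ultimately show ?thesis using U by blast
qed

text \<open>Induction by deflation. In an orthonormal basis starting with an eigenvector for
  \<open>e\<close>, the first column of the matrix is \<open>e\<close> followed by zeros; being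
  Hermitian, its first row has the same form and \<open>e\<close> is real. The remaining block is
  Hermitian of size \<open>n\<close>.\<close>

theorem hermitian_unitary_diagonalization:
  assumes "A \<in> carrier_mat n n" "dagger A = A"
  shows "\<exists>U (l :: nat \<Rightarrow> real). U \<in> carrier_mat n n \<and> dagger U * U = 1\<^sub>m n \<and>
           A = U * mat_diag n (\<lambda>i. of_real (l i)) * dagger U"
  using assms
proof (induction n arbitrary: A)
  case 0
  show ?case
    by (rule exI[of _ "1\<^sub>m 0"], rule exI[of _ "\<lambda>_. 0"]) (use 0 in \<open>auto intro!: eq_matI\<close>)
next
  case (Suc n)
  let ?N = "Suc n"
  note A = Suc.prems(1)
  note [simp] = mult_carrier_mat[of _ ?N ?N _ ?N]
  \<comment> \<open>Over the complex numbers the characteristic polynomial splits, and the positive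
    dimension guarantees a root.\<close>
  obtain as where as: "char_poly A = (\<Prod>a\<leftarrow>as. [:- a, 1:])" "length as = ?N"
    using char_poly_factorized[OF A] by auto
  then obtain e es where "as = e # es" by (cases as) auto
  then have "poly (char_poly A) e = 0" using as by simp
  then have "eigenvalue A e" using eigenvalue_root_char_poly[OF A] by simp
  then obtain v where v: "v \<in> carrier_vec ?N" "v \<noteq> 0\<^sub>v ?N" "A *\<^sub>v v = e \<cdot>\<^sub>v v"
    using A unfolding eigenvalue_def eigenvector_def by auto
  obtain U c where U: "U \<in> carrier_mat ?N ?N" "dagger U * U = 1\<^sub>m ?N" "col U 0 = c \<cdot>\<^sub>v v"
    using ex_unitary_first_column[OF v(1,2)] by auto
  have dU: "dagger U \<in> carrier_mat ?N ?N" using U by simp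
  have UU: "U * dagger U = 1\<^sub>m ?N"
    by (rule mat_mult_left_right_inverse[OF dU U(1,2)])
  define A' where "A' = dagger U * A * U"
  have A': "A' \<in> carrier_mat ?N ?N" unfolding A'_def using U A dU by (intro mult_carrier_mat)
  have AU: "A = U * A' * dagger U"
  proof -
    have "U * A' * dagger U = (U * dagger U) * A * (U * dagger U)"
      unfolding A'_def using U(1) dU A by (simp add: assoc_mult_mat[of _ ?N ?N _ ?N _ ?N])
    then show ?thesis using A by (simp add: UU)
  qed
  have A'h: "dagger A' = A'"
    unfolding A'_def using U(1) dU A Suc.prems(2)
    by (simp add: dagger_mult[of _ ?N ?N _ ?N] assoc_mult_mat[of _ ?N ?N _ ?N _ ?N])
  have "A *\<^sub>v col U 0 = e \<cdot>\<^sub>v col U 0"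
    using v A U(3) by (simp add: mult_mat_vec smult_smult_assoc mult.commute)
  then have "col (A * U) 0 = e \<cdot>\<^sub>v col U 0"
    using col_mult2[OF A U(1), of 0] by simp
  then have AUcol: "(A * U) $$ (i, 0) = e * U $$ (i, 0)" if "i < ?N" for i
    using A U(1) that by (metis (no_types, lifting) carrier_matD(1,2) index_col index_mult_mat(2,3) index_smult_vec(1) zero_less_Suc dim_col)
  have col0: "A' $$ (i, 0) = (if i = 0 then e else 0)" if i: "i < ?N" for i
  proof -
    have "A' $$ (i, 0) = (dagger U * (A * U)) $$ (i, 0)"
      unfolding A'_def using U(1) dU A by (simp add: assoc_mult_mat[of _ ?N ?N _ ?N _ ?N])
    also have "\<dots> = (\<Sum>x<?N. dagger U $$ (i, x) * (A * U) $$ (x, 0))"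
      using U(1) dU A i by (intro index_mult_mat_sum) auto
    also have "\<dots> = (\<Sum>x<?N. e * (dagger U $$ (i, x) * U $$ (x, 0)))"
      by (intro sum.cong refl) (subst AUcol, auto)
    also have "\<dots> = e * (dagger U * U) $$ (i, 0)"
      by (subst index_mult_mat_sum[OF dU U(1) i]) (simp_all only: sum_distrib_left zero_less_Suc)
    finally show ?thesis using U(2) i by simp
  qed
  have A'sym: "A' $$ (i, j) = cnj (A' $$ (j, i))" if "i < ?N" "j < ?N" for i j
    using A'h that A' by (metis carrier_matD(1,2) index_dagger)
  have row0: "A' $$ (0, j) = (if j = 0 then e else 0)" if "j < ?N" for j
    using A'sym[of 0 j] col0[OF that] col0[of 0] A'sym[of 0 0] that by auto
  have e: "e = of_real (Re e)"
    using A'sym[of 0 0] col0[of 0] by (simp add: complex_eq_iff)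
  define A3 where "A3 = mat n n (\<lambda>(i, j). A' $$ (Suc i, Suc j))"
  have A3: "A3 \<in> carrier_mat n n" by (simp add: A3_def)
  have "dagger A3 = A3"
    by (rule eq_matI) (auto simp: A3_def intro!: A'sym[symmetric])
  from Suc.IH[OF A3 this] obtain V l where V: "V \<in> carrier_mat n n" "dagger V * V = 1\<^sub>m n"
    and A3V: "A3 = V * mat_diag n (\<lambda>i. complex_of_real (l i)) * dagger V" by blast
  \<comment> \<open>The new spectrum prepends \<open>e\<close>. \<open>F\<close> fixes the first
    basis vector and acts as \<open>V\<close> on the others, so that \<open>U * F\<close>
    diagonalises \<open>A\<close>.\<close>
  define l' where "l' i = (case i of 0 \<Rightarrow> Re e | Suc j \<Rightarrow> l j)" for i
  define F where "F = four_block_mat (1\<^sub>m 1) (0\<^sub>m 1 n) (0\<^sub>m n 1) V"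
  have F: "F \<in> carrier_mat ?N ?N"
    using four_block_carrier_mat[of "1\<^sub>m 1" 1 1 V n n] V by (simp add: F_def)
  have dF: "dagger F = four_block_mat (1\<^sub>m 1) (0\<^sub>m 1 n) (0\<^sub>m n 1) (dagger V)"
    by (rule eq_matI) (use V in \<open>auto simp: F_def\<close>)
  have dF': "dagger F \<in> carrier_mat ?N ?N" using F by simp
  have FF: "dagger F * F = 1\<^sub>m ?N"
  proof -
    have "dagger F * F = four_block_mat (1\<^sub>m 1) (0\<^sub>m 1 n) (0\<^sub>m n 1) (1\<^sub>m n)"
      unfolding dF unfolding F_def
      by (subst mult_four_block_mat[of _ 1 1 _ n _ n]) (use V in auto)
    then show ?thesis by simp
  qed
  have diag: "mat_diag ?N (\<lambda>i. complex_of_real (l' i)) =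
      four_block_mat (mat 1 1 (\<lambda>_. e)) (0\<^sub>m 1 n) (0\<^sub>m n 1) (mat_diag n (\<lambda>i. of_real (l i)))"
    by (rule eq_matI) (use e in \<open>auto simp: mat_diag_def l'_def split: nat.splits\<close>)
  have "A' = four_block_mat (mat 1 1 (\<lambda>_. e)) (0\<^sub>m 1 n) (0\<^sub>m n 1) A3"
    by (rule eq_matI) (use A' row0 col0 in \<open>auto simp: A3_def\<close>)
  also have "\<dots> = F * mat_diag ?N (\<lambda>i. of_real (l' i)) * dagger F"
    unfolding diag dF unfolding F_def A3V
    apply (subst mult_four_block_mat[of _ 1 1 _ n _ n])
    using V apply (auto)[8]
    apply (subst mult_four_block_mat[of _ 1 1 _ n _ n])
    using V by (auto simp: mat_diag_def)
  finally have A'F: "A' = F * mat_diag ?N (\<lambda>i. of_real (l' i)) * dagger F" .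
  have D: "mat_diag ?N (\<lambda>i. complex_of_real (l' i)) \<in> carrier_mat ?N ?N" by simp
  have "dagger (U * F) * (U * F) = dagger F * (dagger U * U) * F"
    using U(1) dU F dF' by (simp add: dagger_mult[of _ ?N ?N _ ?N] assoc_mult_mat[of _ ?N ?N _ ?N _ ?N])
  then have "dagger (U * F) * (U * F) = 1\<^sub>m ?N"
    using U(2) FF by (simp add: right_mult_one_mat[OF dF'])
  moreover have "A = (U * F) * mat_diag ?N (\<lambda>i. of_real (l' i)) * dagger (U * F)"
    unfolding AU A'F using U(1) dU F dF' D
    by (simp add: dagger_mult[of _ ?N ?N _ ?N] assoc_mult_mat[of _ ?N ?N _ ?N _ ?N])
  ultimately show ?case
    using U(1) F by (intro exI[of _ "U * F"] exI[of _ l']) auto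
qed

section \<open>Positive semidefinite matrices\<close>

text \<open>Only the values of \<open>l\<close> below \<open>n\<close> matter. Since
  \<open>U\<close> is square, the single equation \<open>dagger U * U = 1\<^sub>m n\<close> makes it
  unitary.\<close>

definition spectral_decomp :: "nat \<Rightarrow> complex mat \<Rightarrow> complex mat \<Rightarrow> (nat \<Rightarrow> real) \<Rightarrow> bool" where
  "spectral_decomp n A U l \<longleftrightarrow> A \<in> carrier_mat n n \<and> U \<in> carrier_mat n n \<and>
     dagger U * U = 1\<^sub>m n \<and> A = U * mat_diag n (\<lambda>i. of_real (l i)) * dagger U"

lemma dagger_self_mult_eq_one_iff:
  assumes "U \<in> carrier_mat n n"
  shows "dagger U * U = 1\<^sub>m n \<longleftrightarrow>
    (\<forall>a<n. \<forall>b<n. (\<Sum>i<n. cnj (U $$ (i, a)) * U $$ (i, b)) = (if a = b then 1 else 0))"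
proof -
  have *: "(dagger U * U) $$ (a, b) = (\<Sum>i<n. cnj (U $$ (i, a)) * U $$ (i, b))" if "a < n" "b < n" for a b
    using assms that by (subst index_mult_mat_sum[of _ n n _ n]) auto
  show ?thesis
  proof
    assume "dagger U * U = 1\<^sub>m n"
    then show "\<forall>a<n. \<forall>b<n. (\<Sum>i<n. cnj (U $$ (i, a)) * U $$ (i, b)) = (if a = b then 1 else 0)"
      by (simp flip: *)
  next
    assume "\<forall>a<n. \<forall>b<n. (\<Sum>i<n. cnj (U $$ (i, a)) * U $$ (i, b)) = (if a = b then 1 else 0)"
    then show "dagger U * U = 1\<^sub>m n"
      by (intro eq_matI) (use assms * in auto)
  qed
qed

text \<open>The entrywise form writes \<open>A\<close> as a sum of rank-one operators on the columns
  of \<open>U\<close>, weighted by \<open>l\<close>; later manipulations of sums start from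
  it.\<close>

lemma spectral_decomp_iff:
  assumes A: "A \<in> carrier_mat n n" and U: "U \<in> carrier_mat n n"
  shows "spectral_decomp n A U l \<longleftrightarrow> dagger U * U = 1\<^sub>m n \<and>
     (\<forall>i<n. \<forall>j<n. A $$ (i, j) = (\<Sum>x<n. of_real (l x) * U $$ (i, x) * cnj (U $$ (j, x))))"
proof -
  let ?D = "mat_diag n (\<lambda>i. complex_of_real (l i))"
  have *: "(U * ?D * dagger U) $$ (i, j) = (\<Sum>x<n. of_real (l x) * U $$ (i, x) * cnj (U $$ (j, x)))"
    if "i < n" "j < n" for i j
    unfolding mat_diag_mult_right[OF U]
    using U that by (subst index_mult_mat_sum[of _ n n _ n]) (auto intro!: sum.cong)
  have "A = U * ?D * dagger U \<longleftrightarrow> (\<forall>i<n. \<forall>j<n. A $$ (i, j) = (U * ?D * dagger U) $$ (i, j))"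
    using A U by (auto intro!: eq_matI)
  then show ?thesis
    using A U * by (auto simp: spectral_decomp_def)
qed

lemma proots_prod_linear_factors:
  "proots (\<Prod>a\<leftarrow>xs. [:- a, 1:]) = mset (xs :: complex list)"
proof (induction xs)
  case (Cons x xs)
  have "(\<Prod>a\<leftarrow>xs. [:- a, 1:]) \<noteq> 0"
    by (auto simp: prod_list_zero_iff)
  with Cons show ?case by (simp add: proots_mult del: mult_pCons_left)
qed simp

text \<open>Links the definition through roots of the characteristic polynomial to a
  diagonalisation: \<open>A\<close> is similar to the diagonal matrix of \<open>l\<close>, whose
  characteristic polynomial is the product of the factors \<open>X - l i\<close>.\<close>

lemma vn_entropy_spectral:
  assumes "spectral_decomp n A U l"
  shows "vn_entropy A = - (\<Sum>i<n. eta (l i))"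
proof -
  let ?D = "mat_diag n (\<lambda>i. complex_of_real (l i))"
  from assms have A: "A \<in> carrier_mat n n" and U: "U \<in> carrier_mat n n" and UU: "dagger U * U = 1\<^sub>m n"
    and AU: "A = U * ?D * dagger U" by (auto simp: spectral_decomp_def)
  have dU: "dagger U \<in> carrier_mat n n" using U by simp
  have "U * dagger U = 1\<^sub>m n"
    by (rule mat_mult_left_right_inverse[OF dU U UU])
  then have "similar_mat A ?D"
    unfolding similar_mat_def similar_mat_wit_def Let_def
    using A U dU UU AU by (intro exI[of _ U] exI[of _ "dagger U"]) auto
  then have "char_poly A = char_poly ?D" by (rule char_poly_similar)
  also have "\<dots> = (\<Prod>a\<leftarrow>diag_mat ?D. [:- a, 1:])"
    by (rule char_poly_upper_triangular[of _ n]) (auto simp: upper_triangular_def mat_diag_def)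
  finally have "char_poly A = (\<Prod>a\<leftarrow>diag_mat ?D. [:- a, 1:])" .
  moreover have "diag_mat ?D = map (\<lambda>i. complex_of_real (l i)) [0..<n]"
    by (auto simp: diag_mat_def mat_diag_def)
  ultimately have "proots (char_poly A) = image_mset (\<lambda>i. complex_of_real (l i)) (mset [0..<n])"
    by (simp only: proots_prod_linear_factors mset_map)
  then show ?thesis
    by (simp add: vn_entropy_def image_mset.compositionality comp_def sum_unfold_sum_mset atLeast0LessThan)
qed

lemma spectral_decomp_trace:
  assumes "spectral_decomp n A U l"
  shows "mtrace A = of_real (\<Sum>i<n. l i)"
proof -
  from assms have A: "A \<in> carrier_mat n n" and U: "U \<in> carrier_mat n n" by (auto simp: spectral_decomp_def)
  from assms have UU: "\<And>a b. a < n \<Longrightarrow> b < n \<Longrightarrow> (\<Sum>i<n. cnj (U $$ (i, a)) * U $$ (i, b)) = (if a = b then 1 else 0)"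
    and AU: "\<And>i j. i < n \<Longrightarrow> j < n \<Longrightarrow> A $$ (i, j) = (\<Sum>x<n. of_real (l x) * U $$ (i, x) * cnj (U $$ (j, x)))"
    unfolding spectral_decomp_iff[OF A U] dagger_self_mult_eq_one_iff[OF U] by blast+
  have "mtrace A = (\<Sum>i<n. \<Sum>x<n. of_real (l x) * U $$ (i, x) * cnj (U $$ (i, x)))"
    using A AU by (simp add: mtrace_def)
  also have "\<dots> = (\<Sum>x<n. \<Sum>i<n. of_real (l x) * U $$ (i, x) * cnj (U $$ (i, x)))"
    by (rule sum.swap)
  also have "\<dots> = (\<Sum>x<n. of_real (l x) * (\<Sum>i<n. cnj (U $$ (i, x)) * U $$ (i, x)))"
    by (simp add: sum_distrib_left mult_ac)
  also have "\<dots> = (\<Sum>x<n. of_real (l x))"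
    by (intro sum.cong refl) (simp add: UU)
  finally show ?thesis by simp
qed

text \<open>Vectors are functions here, so that columns of matrices can be inserted directly; only
  values below \<open>n\<close> count.\<close>

definition qform :: "nat \<Rightarrow> complex mat \<Rightarrow> (nat \<Rightarrow> complex) \<Rightarrow> complex" where
  "qform n A v = (\<Sum>i<n. \<Sum>j<n. cnj (v i) * A $$ (i, j) * v j)"

text \<open>Each index \<open>x\<close> contributes a rank-one operator, whose form is a squared
  modulus. Taking \<open>c x = 1\<close> yields positivity of Gram matrices; taking eigenvalues for
  \<open>c\<close> yields the form in spectral coordinates.\<close>

lemma qform_weighted_gram:
  assumes "\<And>i j. i < n \<Longrightarrow> j < n \<Longrightarrow> A $$ (i, j) = (\<Sum>x\<in>I. of_real (c x) * W i x * cnj (W j x))"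
  shows "qform n A v = of_real (\<Sum>x\<in>I. c x * (cmod (\<Sum>i<n. cnj (v i) * W i x))\<^sup>2)"
proof -
  have "qform n A v = (\<Sum>i<n. \<Sum>j<n. \<Sum>x\<in>I. of_real (c x) * (cnj (v i) * W i x) * cnj (cnj (v j) * W j x))"
    unfolding qform_def
    by (intro sum.cong refl) (simp add: assms sum_distrib_left sum_distrib_right mult_ac)
  also have "\<dots> = (\<Sum>x\<in>I. \<Sum>i<n. \<Sum>j<n. of_real (c x) * (cnj (v i) * W i x) * cnj (cnj (v j) * W j x))"
    \<comment> \<open>Fixing \<open>B\<close> directs the rule: the sum over \<open>I\<close> moves
      outwards past the other two and stops there.\<close>
    by (simp only: sum.swap[where B = I])
  also have "\<dots> = (\<Sum>x\<in>I. of_real (c x) * ((\<Sum>i<n. cnj (v i) * W i x) * cnj (\<Sum>j<n. cnj (v j) * W j x)))"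
    by (simp only: cnj_sum sum_product) (simp only: sum_distrib_left mult.assoc)
  also have "\<dots> = of_real (\<Sum>x\<in>I. c x * (cmod (\<Sum>i<n. cnj (v i) * W i x))\<^sup>2)"
    by (simp only: of_real_sum of_real_mult complex_norm_square)
  finally show ?thesis .
qed

lemma psd_iff_qform:
  "psd n A \<longleftrightarrow> A \<in> carrier_mat n n \<and> (\<forall>i<n. \<forall>j<n. A $$ (i, j) = cnj (A $$ (j, i))) \<and>
     (\<forall>v. Im (qform n A v) = 0 \<and> 0 \<le> Re (qform n A v))"
proof -
  have 1: "(\<Sum>i<n. \<Sum>j<n. cnj (v $ i) * A $$ (i, j) * v $ j) = qform n A (($) v)" for v
    by (simp add: qform_def)
  have 2: "qform n A v = qform n A (($) (vec n v))" for v
    by (simp add: qform_def)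
  have "(\<forall>v\<in>carrier_vec n. P (qform n A (($) v))) \<longleftrightarrow> (\<forall>v. P (qform n A v))" for P
    using 2 by (metis vec_carrier)
  from this[of "\<lambda>z. Im z = 0 \<and> 0 \<le> Re z"] show ?thesis
    unfolding psd_def 1 by simp
qed

text \<open>The index set \<open>I\<close> is arbitrary because the Gram vectors of partial traces
  are indexed by pairs.\<close>

lemma psd_gramI:
  assumes "A \<in> carrier_mat n n"
    and "\<And>i j. i < n \<Longrightarrow> j < n \<Longrightarrow> A $$ (i, j) = (\<Sum>x\<in>I. W i x * cnj (W j x))"
  shows "psd n A"
proof -
  have "qform n A v = of_real (\<Sum>x\<in>I. 1 * (cmod (\<Sum>i<n. cnj (v i) * W i x))\<^sup>2)" for v
    by (rule qform_weighted_gram) (simp add: assms)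
  then show ?thesis
    using assms by (auto simp: psd_iff_qform mult.commute intro!: sum_nonneg)
qed

text \<open>The eigenvalue \<open>l b\<close> is the value of the form at column \<open>b\<close> of
  \<open>U\<close>, hence nonnegative.\<close>

lemma psd_spectral:
  assumes "psd n A"
  obtains U l where "spectral_decomp n A U l" "\<And>i. i < n \<Longrightarrow> 0 \<le> l i"
proof -
  from assms have A: "A \<in> carrier_mat n n" and h: "\<And>i j. i < n \<Longrightarrow> j < n \<Longrightarrow> A $$ (i, j) = cnj (A $$ (j, i))"
    and pos: "\<And>v. 0 \<le> Re (qform n A v)"
    unfolding psd_iff_qform by blast+
  have "dagger A = A"
    by (rule eq_matI) (use A in \<open>auto intro!: h[symmetric]\<close>)
  with hermitian_unitary_diagonalization[OF A] obtain U l
    where s: "spectral_decomp n A U l" using A by (auto simp: spectral_decomp_def)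
  then have U: "U \<in> carrier_mat n n" by (simp add: spectral_decomp_def)
  from s have UU: "\<And>a b. a < n \<Longrightarrow> b < n \<Longrightarrow> (\<Sum>i<n. cnj (U $$ (i, a)) * U $$ (i, b)) = (if a = b then 1 else 0)"
    and AU: "\<And>i j. i < n \<Longrightarrow> j < n \<Longrightarrow> A $$ (i, j) = (\<Sum>x<n. of_real (l x) * U $$ (i, x) * cnj (U $$ (j, x)))"
    unfolding spectral_decomp_iff[OF A U] dagger_self_mult_eq_one_iff[OF U] by blast+
  have "0 \<le> l b" if b: "b < n" for b
  proof -
    have "qform n A (\<lambda>i. U $$ (i, b)) =
        of_real (\<Sum>x<n. l x * (cmod (\<Sum>i<n. cnj (U $$ (i, b)) * U $$ (i, x)))\<^sup>2)"
      by (rule qform_weighted_gram) (rule AU)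
    also have "(\<Sum>x<n. l x * (cmod (\<Sum>i<n. cnj (U $$ (i, b)) * U $$ (i, x)))\<^sup>2) =
        (\<Sum>x<n. if x = b then l x else 0)"
      by (intro sum.cong refl) (simp add: UU b)
    also have "\<dots> = l b" using b by simp
    finally show ?thesis using pos[of "\<lambda>i. U $$ (i, b)"] by simp
  qed
  with s that show ?thesis by blast
qed

text \<open>Scale the columns of \<open>U\<close> by the square roots of the eigenvalues.\<close>

lemma psd_gramE:
  assumes "psd n A"
  obtains W where "W \<in> carrier_mat n n" "A = W * dagger W"
proof -
  obtain U l where s: "spectral_decomp n A U l" and l: "\<And>i. i < n \<Longrightarrow> 0 \<le> l i"
    using psd_spectral[OF assms] by blast
  then have A: "A \<in> carrier_mat n n" and U: "U \<in> carrier_mat n n" by (auto simp: spectral_decomp_def)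
  from s have AU: "\<And>i j. i < n \<Longrightarrow> j < n \<Longrightarrow> A $$ (i, j) = (\<Sum>x<n. of_real (l x) * U $$ (i, x) * cnj (U $$ (j, x)))"
    unfolding spectral_decomp_iff[OF A U] by blast
  define W where "W = mat n n (\<lambda>(i, x). of_real (sqrt (l x)) * U $$ (i, x))"
  have W: "W \<in> carrier_mat n n" by (simp add: W_def)
  have "A = W * dagger W"
  proof (rule eq_matI)
    fix i j assume "i < dim_row (W * dagger W)" "j < dim_col (W * dagger W)"
    then have ij: "i < n" "j < n" using W by auto
    have "(W * dagger W) $$ (i, j) = (\<Sum>x<n. W $$ (i, x) * cnj (W $$ (j, x)))"
      using W ij by (subst index_mult_mat_sum[of _ n n _ n]) auto
    also have "\<dots> = (\<Sum>x<n. of_real (sqrt (l x) * sqrt (l x)) * U $$ (i, x) * cnj (U $$ (j, x)))"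
      by (intro sum.cong refl) (simp add: W_def ij mult_ac del: real_sqrt_mult_self)
    also have "\<dots> = (\<Sum>x<n. of_real (l x) * U $$ (i, x) * cnj (U $$ (j, x)))"
      by (intro sum.cong refl) (simp only: lessThan_iff real_sqrt_mult_self abs_of_nonneg l)
    finally show "A $$ (i, j) = (W * dagger W) $$ (i, j)" using AU ij by simp
  qed (use A W in auto)
  with W that show ?thesis by blast
qed

lemma psd_mult_dagger:
  assumes "W \<in> carrier_mat n m"
  shows "psd n (W * dagger W)"
proof (rule psd_gramI[where I = "{..<m}" and W = "\<lambda>i x. W $$ (i, x)"])
  fix i j assume "i < n" "j < n"
  then show "(W * dagger W) $$ (i, j) = (\<Sum>x<m. W $$ (i, x) * cnj (W $$ (j, x)))"
    using assms by (subst index_mult_mat_sum[of _ n m _ n]) auto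
qed (use assms in auto)

section \<open>Von Neumann entropy\<close>

text \<open>Sylvester's identity: \<open>A * B\<close> and \<open>B * A\<close> have the same
  nonzero eigenvalues with multiplicities, the powers of the indeterminate making up for their
  different sizes.\<close>

lemma char_poly_mult_commute:
  fixes A B :: "complex mat"
  assumes A: "A \<in> carrier_mat m n" and B: "B \<in> carrier_mat n m"
  shows "[:0, 1:] ^ n * char_poly (A * B) = [:0, 1:] ^ m * char_poly (B * A)"
proof -
  define X :: "complex poly" where "X = [:0, 1:]"
  define pA where "pA = map_mat (\<lambda>a. [:a:]) A"
  define pB where "pB = map_mat (\<lambda>a. [:a:]) B"
  have pA: "pA \<in> carrier_mat m n" and pB: "pB \<in> carrier_mat n m"
    using A B by (auto simp: pA_def pB_def)
  have pmult: "map_mat (\<lambda>a. [:a:]) (C * D) = map_mat (\<lambda>a. [:a:]) C * map_mat (\<lambda>a. [:a:]) D"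
    if "C \<in> carrier_mat p q" "D \<in> carrier_mat q p" for C D :: "complex mat" and p q
  proof (rule eq_matI)
    have hom: "[:\<Sum>x<q. f x:] = (\<Sum>x<q. [:f x:])" for f :: "nat \<Rightarrow> complex"
      by (induction q) (simp, drule sym, simp)
    fix i j
    assume "i < dim_row (map_mat (\<lambda>a. [:a:]) C * map_mat (\<lambda>a. [:a:]) D)"
      "j < dim_col (map_mat (\<lambda>a. [:a:]) C * map_mat (\<lambda>a. [:a:]) D)"
    then show "map_mat (\<lambda>a. [:a:]) (C * D) $$ (i, j) =
        (map_mat (\<lambda>a. [:a:]) C * map_mat (\<lambda>a. [:a:]) D) $$ (i, j)"
      using that by (simp add: scalar_prod_def atLeast0LessThan hom mult.commute)
  qed (use that in auto)
  have cp: "char_poly C = det (X \<cdot>\<^sub>m 1\<^sub>m p - map_mat (\<lambda>a. [:a:]) C)" if "C \<in> carrier_mat p p" for C :: "complex mat" and p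
    unfolding char_poly_defs X_def
    by (rule arg_cong[of _ _ det], rule eq_matI) (use that in auto)
  \<comment> \<open>The determinant of M is evaluated twice, by clearing its lower left block (multiplying with
     R1) and its upper right block (multiplying with R2).\<close>
  define M where "M = four_block_mat (X \<cdot>\<^sub>m 1\<^sub>m m) pA pB (1\<^sub>m n)"
  define R1 where "R1 = four_block_mat (1\<^sub>m m) (0\<^sub>m m n) (- pB) (1\<^sub>m n)"
  define R2 where "R2 = four_block_mat (1\<^sub>m m) (- pA) (0\<^sub>m n m) (X \<cdot>\<^sub>m 1\<^sub>m n)"
  have M: "M \<in> carrier_mat (m + n) (m + n)" and R1: "R1 \<in> carrier_mat (m + n) (m + n)"
    and R2: "R2 \<in> carrier_mat (m + n) (m + n)"
    unfolding M_def R1_def R2_def by (rule four_block_carrier_mat; simp)+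
  have MR1: "M * R1 = four_block_mat (X \<cdot>\<^sub>m 1\<^sub>m m - pA * pB) pA (0\<^sub>m n m) (1\<^sub>m n)"
    unfolding M_def R1_def
    apply (subst mult_four_block_mat[of _ m m _ n _ n])
    using pA pB by (auto intro!: cong_four_block_mat eq_matI)
  have "X \<cdot>\<^sub>m 1\<^sub>m m * (- pA) = X \<cdot>\<^sub>m (- pA)"
    using pA by (subst mult_smult_assoc_mat[of _ m m _ n]) auto
  moreover have "pA * (X \<cdot>\<^sub>m 1\<^sub>m n) = X \<cdot>\<^sub>m pA"
    using pA by (subst mult_smult_distrib[of _ m n _ n]) auto
  ultimately have MR2: "M * R2 = four_block_mat (X \<cdot>\<^sub>m 1\<^sub>m m) (0\<^sub>m m n) pB (X \<cdot>\<^sub>m 1\<^sub>m n - pB * pA)"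
    unfolding M_def R2_def
    apply (subst mult_four_block_mat[of _ m m _ n _ n])
    using pA pB by (auto simp del: index_mult_mat(1) intro!: cong_four_block_mat eq_matI)
  have "det M * det R1 = det (X \<cdot>\<^sub>m 1\<^sub>m m - pA * pB) * det (1\<^sub>m n)"
    unfolding det_mult[OF M R1, symmetric] MR1
    by (rule det_four_block_mat_lower_left_zero) (use pA pB in auto)
  moreover have "det R1 = det (1\<^sub>m m) * det (1\<^sub>m n)"
    unfolding R1_def by (rule det_four_block_mat_upper_right_zero) (use pA pB in auto)
  ultimately have 1: "det M = char_poly (A * B)"
    using pmult[OF A B] cp[of "A * B" m] A B by (simp add: pA_def pB_def)
  have "det M * det R2 = det (X \<cdot>\<^sub>m 1\<^sub>m m) * det (X \<cdot>\<^sub>m 1\<^sub>m n - pB * pA)"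
    unfolding det_mult[OF M R2, symmetric] MR2
    by (rule det_four_block_mat_upper_right_zero) (use pA pB in auto)
  moreover have "det R2 = det (1\<^sub>m m) * det (X \<cdot>\<^sub>m 1\<^sub>m n)"
    unfolding R2_def by (rule det_four_block_mat_lower_left_zero) (use pA pB in auto)
  ultimately have "det M * X ^ n = X ^ m * char_poly (B * A)"
    using pmult[OF B A] cp[of "B * A" n] A B by (simp add: pA_def pB_def det_smult)
  with 1 show ?thesis by (simp add: X_def mult.commute)
qed

lemma eta_0 [simp]: "eta 0 = 0"
  by (simp add: eta_def)

lemma eta_1 [simp]: "eta 1 = 0"
  by (simp add: eta_def)

lemma eta_nonpos: "x \<le> 1 \<Longrightarrow> eta x \<le> 0"
  by (auto simp: eta_def mult_nonneg_nonpos)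

lemma char_poly_nonzero:
  fixes A :: "complex mat"
  shows "A \<in> carrier_mat n n \<Longrightarrow> char_poly A \<noteq> 0"
  using degree_monic_char_poly[of A n] by auto

text \<open>Powers of the indeterminate add only zero roots, on which \<open>eta\<close> vanishes.
  This moves the entropy of \<open>W * dagger W\<close> to \<open>dagger W * W\<close>, also for
  rectangular \<open>W\<close>.\<close>

lemma vn_entropy_mult_commute:
  assumes A: "A \<in> carrier_mat m n" and B: "B \<in> carrier_mat n m"
  shows "vn_entropy (A * B) = vn_entropy (B * A)"
proof -
  let ?S = "\<lambda>p :: complex poly. \<Sum>z\<in>#proots p. eta (Re z)"
  have S: "?S ([:0, 1:] ^ i * p) = ?S p" if "p \<noteq> 0" for i p
    using that by (subst proots_mult) (auto simp: proots_power proots_linear_factor[of 0, simplified] sum_mset_constant)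
  have "?S (char_poly (A * B)) = ?S ([:0, 1:] ^ n * char_poly (A * B))"
    by (rule S[symmetric], rule char_poly_nonzero[of _ m]) (use A B in auto)
  also have "\<dots> = ?S (char_poly (B * A))"
    unfolding char_poly_mult_commute[OF A B]
    by (rule S, rule char_poly_nonzero[of _ n]) (use A B in auto)
  finally show ?thesis by (simp add: vn_entropy_def)
qed

text \<open>The characteristic matrix inherits the block form, so the characteristic polynomial is a
  product and the root multisets add up.\<close>

lemma vn_entropy_four_block_diag:
  assumes A: "A \<in> carrier_mat m m" and D: "D \<in> carrier_mat n n"
  shows "vn_entropy (four_block_mat A (0\<^sub>m m n) (0\<^sub>m n m) D) = vn_entropy A + vn_entropy D"
proof -
  have "char_poly_matrix (four_block_mat A (0\<^sub>m m n) (0\<^sub>m n m) D) =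
      four_block_mat (char_poly_matrix A) (0\<^sub>m m n) (0\<^sub>m n m) (char_poly_matrix D)"
    unfolding char_poly_matrix_def by (rule eq_matI) (use A D in auto)
  then have "char_poly (four_block_mat A (0\<^sub>m m n) (0\<^sub>m n m) D) = char_poly A * char_poly D"
    unfolding char_poly_def
    using A D by (simp add: det_four_block_mat_upper_right_zero[of _ m _ n])
  then show ?thesis
    using char_poly_nonzero[OF A] char_poly_nonzero[OF D]
    by (simp add: vn_entropy_def proots_mult)
qed

lemma vn_entropy_1x1: "vn_entropy (mat 1 1 (\<lambda>_. z)) = - eta (Re z)"
  by (simp add: vn_entropy_def char_poly_defs det_single)

section \<open>Scaling, trace and normalisation of positive operators\<close>

lemma spectral_decomp_smult:
  assumes "spectral_decomp n A U l"
  shows "spectral_decomp n (of_real c \<cdot>\<^sub>m A) U (\<lambda>i. c * l i)"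
proof -
  from assms have A: "A \<in> carrier_mat n n" and U: "U \<in> carrier_mat n n"
    by (auto simp: spectral_decomp_def)
  from assms show ?thesis
    unfolding spectral_decomp_iff[OF A U] spectral_decomp_iff[OF smult_carrier_mat[OF A] U]
    using A by (auto simp: sum_distrib_left mult.assoc)
qed

text \<open>The product rule of \<open>x * ln x\<close>; vanishing factors agree by
  \<open>eta 0 = 0\<close>.\<close>

lemma eta_mult:
  assumes "0 \<le> x" "0 \<le> y"
  shows "eta (x * y) = x * eta y + y * eta x"
  using assms by (cases "x = 0"; cases "y = 0")
    (auto simp: eta_def mult_le_0_iff ln_mult algebra_simps)

text \<open>By the product rule of \<open>eta\<close> each eigenvalue \<open>l i\<close> yields the
  extra term \<open>l i * eta c\<close>, and the \<open>l i\<close> sum to the trace. It serves the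
  weighted, unnormalised blocks of a state.\<close>

lemma vn_entropy_smult:
  assumes "psd n A" "0 \<le> c"
  shows "vn_entropy (of_real c \<cdot>\<^sub>m A) = c * vn_entropy A - eta c * Re (mtrace A)"
proof -
  obtain U l where s: "spectral_decomp n A U l" and l: "\<And>i. i < n \<Longrightarrow> 0 \<le> l i"
    using psd_spectral[OF assms(1)] by blast
  have "(\<Sum>i<n. eta (c * l i)) = (\<Sum>i<n. c * eta (l i) + l i * eta c)"
    by (intro sum.cong refl eta_mult) (use l assms(2) in auto)
  then show ?thesis
    using vn_entropy_spectral[OF s] vn_entropy_spectral[OF spectral_decomp_smult[OF s, of c]]
      spectral_decomp_trace[OF s]
    by (simp add: sum.distrib sum_distrib_left sum_distrib_right mult.commute)
qed

text \<open>Nonnegative eigenvalues of sum 1 lie in the unit interval, where \<open>eta\<close> is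
  nonpositive. This bounds the averages in \<open>H_chan\<close> from below.\<close>

lemma vn_entropy_density_nonneg:
  assumes "density n A"
  shows "0 \<le> vn_entropy A"
proof -
  obtain U l where s: "spectral_decomp n A U l" and l: "\<And>i. i < n \<Longrightarrow> 0 \<le> l i"
    using psd_spectral assms unfolding density_def by blast
  have sum: "(\<Sum>i<n. l i) = 1"
    using spectral_decomp_trace[OF s] assms by (simp add: density_def flip: of_real_sum)
  have "eta (l i) \<le> 0" if i: "i < n" for i
  proof -
    have "l i \<le> (\<Sum>i<n. l i)"
      using l i by (intro member_le_sum) auto
    then show ?thesis
      using sum by (intro eta_nonpos) simp
  qed
  then have "(\<Sum>i<n. eta (l i)) \<le> 0" by (intro sum_nonpos) auto
  then show ?thesis using vn_entropy_spectral[OF s] by simp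
qed

lemma psd_trace_Re_nonneg:
  assumes "psd n A"
  shows "0 \<le> Re (mtrace A)" "mtrace A = of_real (Re (mtrace A))"
proof -
  obtain U l where s: "spectral_decomp n A U l" and l: "\<And>i. i < n \<Longrightarrow> 0 \<le> l i"
    using psd_spectral[OF assms] by blast
  show "0 \<le> Re (mtrace A)" "mtrace A = of_real (Re (mtrace A))"
    using l unfolding spectral_decomp_trace[OF s] by (auto intro!: sum_nonneg)
qed

lemma psd_smult:
  assumes "psd n A" "0 \<le> c"
  shows "psd n (of_real c \<cdot>\<^sub>m A)"
proof -
  have A: "A \<in> carrier_mat n n" using assms(1) by (simp add: psd_def)
  have "qform n (of_real c \<cdot>\<^sub>m A) v = of_real c * qform n A v" for v
    using A by (simp add: qform_def sum_distrib_left mult_ac)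
  then have "Im (qform n (of_real c \<cdot>\<^sub>m A) v) = 0 \<and> 0 \<le> Re (qform n (of_real c \<cdot>\<^sub>m A) v)" for v
    using assms unfolding psd_iff_qform by simp
  moreover have "(of_real c \<cdot>\<^sub>m A) $$ (i, j) = cnj ((of_real c \<cdot>\<^sub>m A) $$ (j, i))" if "i < n" "j < n" for i j
  proof -
    have "A $$ (i, j) = cnj (A $$ (j, i))" using assms(1) that unfolding psd_def by blast
    then show ?thesis using A that by simp
  qed
  ultimately show ?thesis
    using smult_carrier_mat[OF A] unfolding psd_iff_qform by blast
qed

lemma mtrace_smult: "A \<in> carrier_mat n n \<Longrightarrow> mtrace (c \<cdot>\<^sub>m A) = c * mtrace A"
  by (auto simp: mtrace_def sum_distrib_left)

lemma density_mat_unit: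
  assumes "i < n"
  shows "density n (mat_unit n i i)"
proof -
  have "psd n (mat_unit n i i)"
    by (rule psd_gramI[where I = "{i}" and W = "\<lambda>a x. if a = x then 1 else 0"]) (auto simp: mat_unit_def)
  with assms show ?thesis by (simp add: density_def mtrace_def mat_unit_def)
qed

text \<open>Divide by the trace. If it vanishes, so do all eigenvalues and hence \<open>A\<close>;
  any density operator then serves, and one exists because \<open>0 < n\<close>.\<close>

lemma psd_eq_smult_density:
  assumes "psd n A" "0 < n"
  obtains T where "density n T" "A = of_real (Re (mtrace A)) \<cdot>\<^sub>m T"
proof (cases "Re (mtrace A) = 0")
  case True
  obtain U l where s: "spectral_decomp n A U l" and l: "\<And>i. i < n \<Longrightarrow> 0 \<le> l i"
    using psd_spectral[OF assms(1)] by blast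
  then have A: "A \<in> carrier_mat n n" and U: "U \<in> carrier_mat n n" by (auto simp: spectral_decomp_def)
  have "(\<Sum>i<n. l i) = 0"
    using spectral_decomp_trace[OF s] True by simp
  then have l0: "l i = 0" if "i < n" for i
    using l that by (subst (asm) sum_nonneg_eq_0_iff) auto
  have "A = 0 \<cdot>\<^sub>m mat_unit n 0 0"
    by (rule eq_matI) (use s A in \<open>auto simp: spectral_decomp_iff[OF A U] l0 mat_unit_def\<close>)
  with True that[OF density_mat_unit[OF assms(2)]] show ?thesis by simp
next
  case False
  define t where "t = Re (mtrace A)"
  have A: "A \<in> carrier_mat n n" using assms(1) by (simp add: psd_def)
  have t: "t > 0" "mtrace A = of_real t"
    using psd_trace_Re_nonneg[OF assms(1)] False by (auto simp: t_def)
  have "density n (of_real (1 / t) \<cdot>\<^sub>m A)"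
    unfolding density_def using psd_smult[OF assms(1), of "1 / t"] t mtrace_smult[OF A] by simp
  moreover have "A = of_real t \<cdot>\<^sub>m (of_real (1 / t) \<cdot>\<^sub>m A)"
    by (rule eq_matI) (use t in auto)
  ultimately show ?thesis using that by (simp add: t_def)
qed

section \<open>Concavity of the entropy\<close>

text \<open>Convexity of \<open>x * ln x\<close>: the graph lies above the tangent at
  \<open>x\<close>. For \<open>y > 0\<close> this is \<open>ln t \<le> t - 1\<close> at
  \<open>t = x / y\<close>.\<close>

lemma eta_tangent:
  assumes "0 < x" "0 \<le> y"
  shows "eta x + (ln x + 1) * (y - x) \<le> eta y"
proof (cases "y = 0")
  case True
  with assms show ?thesis by (simp add: eta_def algebra_simps)
next
  case False
  with assms have y: "0 < y" by simp
  have "ln (x / y) \<le> x / y - 1"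
    using assms y by (intro ln_le_minus_one) auto
  then have "y * ln (x / y) \<le> y * (x / y - 1)"
    using y by (intro mult_left_mono) auto
  also have "\<dots> = x - y" using y by (simp add: field_simps)
  finally show ?thesis
    using assms y by (simp add: eta_def ln_div algebra_simps)
qed

text \<open>The log-sum inequality with a probability distribution \<open>q\<close> as reference.
  That \<open>g\<close> vanishes wherever \<open>q\<close> does is the absolute continuity familiar
  from relative entropy.\<close>

lemma eta_sum_le:
  fixes g q :: "'a \<Rightarrow> real"
  assumes "finite I" and g: "\<And>i. i \<in> I \<Longrightarrow> 0 \<le> g i" and q: "\<And>i. i \<in> I \<Longrightarrow> 0 \<le> q i"
    and q1: "(\<Sum>i\<in>I. q i) = 1" and gq: "\<And>i. i \<in> I \<Longrightarrow> q i = 0 \<Longrightarrow> g i = 0"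
  shows "eta (\<Sum>i\<in>I. g i) \<le> (\<Sum>i\<in>I. eta (g i) - g i * ln (q i))"
proof (cases "(\<Sum>i\<in>I. g i) = 0")
  case True
  then have "g i = 0" if "i \<in> I" for i
    using sum_nonneg_eq_0_iff[OF assms(1), of g] g that by auto
  with True show ?thesis by simp
next
  case False
  define s where "s = (\<Sum>i\<in>I. g i)"
  have s: "0 < s" using False g by (simp add: s_def sum_nonneg less_le)
  \<comment> \<open>This is the tangent bound after cancelling \<open>g i * ln (q i)\<close>. Both
    \<open>g\<close> and \<open>s * q\<close> have sum \<open>s\<close>, so the terms
    \<open>g i - s * q i\<close> cancel in total.\<close>
  have "g i * ln s + g i - s * q i \<le> eta (g i) - g i * ln (q i)" if i: "i \<in> I" for i
  proof (cases "q i = 0")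
    case True
    with gq[OF i] show ?thesis by simp
  next
    case False
    then have qi: "0 < q i" using q[OF i] by simp
    \<comment> \<open>the tangent of eta at the point that is proportional to q\<close>
    have "eta (s * q i) + (ln (s * q i) + 1) * (g i - s * q i) \<le> eta (g i)"
      using s qi g[OF i] by (intro eta_tangent) auto
    moreover have "eta (s * q i) = s * q i * ln (s * q i)"
      using s qi by (simp add: eta_def mult_le_0_iff)
    moreover have "ln (s * q i) = ln s + ln (q i)"
      using s qi by (simp add: ln_mult)
    ultimately show ?thesis by (simp add: algebra_simps)
  qed
  then have "(\<Sum>i\<in>I. g i * ln s + g i - s * q i) \<le> (\<Sum>i\<in>I. eta (g i) - g i * ln (q i))"
    by (rule sum_mono)
  moreover have "(\<Sum>i\<in>I. g i * ln s + g i - s * q i) = eta s"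
    using s q1 by (simp add: sum.distrib sum_subtractf eta_def flip: sum_distrib_left sum_distrib_right s_def)
  ultimately show ?thesis by (simp add: s_def)
qed

text \<open>The log-sum inequality with \<open>g i = p i * x i\<close> and \<open>q = p\<close>; the
  logarithms of \<open>p\<close> cancel by the product rule \<open>eta_mult\<close>.\<close>

lemma eta_jensen:
  fixes p x :: "'a \<Rightarrow> real"
  assumes "finite I" and p: "\<And>i. i \<in> I \<Longrightarrow> 0 \<le> p i" and x: "\<And>i. i \<in> I \<Longrightarrow> 0 \<le> x i"
    and "(\<Sum>i\<in>I. p i) = 1"
  shows "eta (\<Sum>i\<in>I. p i * x i) \<le> (\<Sum>i\<in>I. p i * eta (x i))"
proof -
  have "eta (\<Sum>i\<in>I. p i * x i) \<le> (\<Sum>i\<in>I. eta (p i * x i) - p i * x i * ln (p i))"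
    using assms by (intro eta_sum_le) auto
  also have "\<dots> = (\<Sum>i\<in>I. p i * eta (x i))"
  proof (intro sum.cong refl)
    fix i assume i: "i \<in> I"
    have "eta (p i) = p i * ln (p i)"
      using p[OF i] by (auto simp: eta_def)
    then show "eta (p i * x i) - p i * x i * ln (p i) = p i * eta (x i)"
      using eta_mult[OF p[OF i] x[OF i]] by simp
  qed
  finally show ?thesis .
qed

section \<open>Diagonals of positive operators in orthonormal bases\<close>

text \<open>\<open>p a b\<close> is the squared modulus of an entry of the unitary
  \<open>dagger V * U\<close>, so the matrix of transition probabilities between the two bases is
  doubly stochastic.\<close>

lemma unitary_entries:
  assumes U: "U \<in> carrier_mat n n" and UU: "dagger U * U = 1\<^sub>m n"
    and V: "V \<in> carrier_mat n n" and VV: "dagger V * V = 1\<^sub>m n"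
  defines "p \<equiv> \<lambda>a b. (cmod (\<Sum>i<n. cnj (V $$ (i, a)) * U $$ (i, b)))\<^sup>2"
  shows "b < n \<Longrightarrow> (\<Sum>a<n. p a b) = 1" and "a < n \<Longrightarrow> (\<Sum>b<n. p a b) = 1"
proof -
  define M where "M = dagger V * U"
  have dU: "dagger U \<in> carrier_mat n n" and dV: "dagger V \<in> carrier_mat n n" using U V by auto
  have M: "M \<in> carrier_mat n n" using dV U by (simp add: M_def)
  have Mp: "of_real (p a b) = M $$ (a, b) * cnj (M $$ (a, b))" if "a < n" "b < n" for a b
  proof -
    have "M $$ (a, b) = (\<Sum>i<n. cnj (V $$ (i, a)) * U $$ (i, b))"
      unfolding M_def by (subst index_mult_mat_sum[OF dV U that]) (use V that in auto)
    then show ?thesis unfolding p_def by (simp only: complex_norm_square)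
  qed
  have UU': "U * dagger U = 1\<^sub>m n" by (rule mat_mult_left_right_inverse[OF dU U UU])
  have VV': "V * dagger V = 1\<^sub>m n" by (rule mat_mult_left_right_inverse[OF dV V VV])
  have dM: "dagger M = dagger U * V"
    unfolding M_def using dV U by (simp add: dagger_mult[of _ n n _ n])
  have "dagger M * M = dagger U * (V * dagger V) * U"
    unfolding dM unfolding M_def using U V dU dV
    by (simp add: assoc_mult_mat[of _ n n _ n _ n] mult_carrier_mat[of _ n n _ n])
  then have MM: "dagger M * M = 1\<^sub>m n" using UU by (simp add: VV' right_mult_one_mat[OF dU])
  have "M * dagger M = dagger V * (U * dagger U) * V"
    unfolding dM unfolding M_def using U V dU dV
    by (simp add: assoc_mult_mat[of _ n n _ n _ n] mult_carrier_mat[of _ n n _ n])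
  then have MM': "M * dagger M = 1\<^sub>m n" using VV by (simp add: UU' right_mult_one_mat[OF dV])
  show "(\<Sum>a<n. p a b) = 1" if b: "b < n"
  proof -
    have "complex_of_real (\<Sum>a<n. p a b) = (\<Sum>a<n. cnj (M $$ (a, b)) * M $$ (a, b))"
      using b by (simp add: Mp mult.commute)
    also have "\<dots> = 1"
      using MM b unfolding dagger_self_mult_eq_one_iff[OF M] by simp
    finally show ?thesis using of_real_eq_1_iff by blast
  qed
  show "(\<Sum>b<n. p a b) = 1" if a: "a < n"
  proof -
    have "complex_of_real (\<Sum>b<n. p a b) = (\<Sum>b<n. M $$ (a, b) * cnj (M $$ (a, b)))"
      using a by (simp add: Mp)
    also have "\<dots> = (M * dagger M) $$ (a, a)"
      using M a by (subst index_mult_mat_sum[of _ n n _ n]) auto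
    also have "\<dots> = 1" using MM' a by simp
    finally show ?thesis using of_real_eq_1_iff by blast
  qed
qed

lemma spectral_decomp_qform:
  assumes "spectral_decomp n A U l"
  shows "qform n A v = of_real (\<Sum>b<n. l b * (cmod (\<Sum>i<n. cnj (v i) * U $$ (i, b)))\<^sup>2)"
proof (rule qform_weighted_gram)
  have "A \<in> carrier_mat n n" "U \<in> carrier_mat n n" using assms by (auto simp: spectral_decomp_def)
  then show "A $$ (i, j) = (\<Sum>x<n. of_real (l x) * U $$ (i, x) * cnj (U $$ (j, x)))" if "i < n" "j < n" for i j
    using assms that by (simp add: spectral_decomp_iff)
qed

text \<open>Expand in the eigenbasis; the column sums of the doubly stochastic transition matrix are
  1.\<close>

lemma trace_unitary_basis:
  assumes "psd n A" and V: "V \<in> carrier_mat n n" "dagger V * V = 1\<^sub>m n"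
  shows "(\<Sum>a<n. Re (qform n A (\<lambda>i. V $$ (i, a)))) = Re (mtrace A)"
proof -
  obtain U l where s: "spectral_decomp n A U l" and l: "\<And>i. i < n \<Longrightarrow> 0 \<le> l i"
    using psd_spectral[OF assms(1)] by blast
  then have U: "U \<in> carrier_mat n n" "dagger U * U = 1\<^sub>m n" by (auto simp: spectral_decomp_def)
  let ?p = "\<lambda>a b. (cmod (\<Sum>i<n. cnj (V $$ (i, a)) * U $$ (i, b)))\<^sup>2"
  have "(\<Sum>a<n. Re (qform n A (\<lambda>i. V $$ (i, a)))) = (\<Sum>a<n. \<Sum>b<n. l b * ?p a b)"
    by (simp add: spectral_decomp_qform[OF s] del: of_real_sum)
  also have "\<dots> = (\<Sum>b<n. l b * (\<Sum>a<n. ?p a b))"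
    by (subst sum.swap) (simp add: sum_distrib_left)
  also have "\<dots> = (\<Sum>b<n. l b)"
    by (intro sum.cong refl) (simp add: unitary_entries(1)[OF U V])
  also have "\<dots> = Re (mtrace A)" using spectral_decomp_trace[OF s] by simp
  finally show ?thesis .
qed

text \<open>The diagonal of \<open>A\<close> in the basis \<open>V\<close> is a doubly stochastic
  image of its spectrum. Jensen's inequality applies to each row, whose sum is 1, and the column
  sums then leave the sum of \<open>eta\<close> over the eigenvalues.\<close>

lemma peierls_inequality:
  assumes "psd n A" and V: "V \<in> carrier_mat n n" "dagger V * V = 1\<^sub>m n"
  shows "(\<Sum>a<n. eta (Re (qform n A (\<lambda>i. V $$ (i, a))))) \<le> - vn_entropy A"
proof -
  obtain U l where s: "spectral_decomp n A U l" and l: "\<And>i. i < n \<Longrightarrow> 0 \<le> l i"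
    using psd_spectral[OF assms(1)] by blast
  then have U: "U \<in> carrier_mat n n" "dagger U * U = 1\<^sub>m n" by (auto simp: spectral_decomp_def)
  let ?p = "\<lambda>a b. (cmod (\<Sum>i<n. cnj (V $$ (i, a)) * U $$ (i, b)))\<^sup>2"
  have "(\<Sum>a<n. eta (Re (qform n A (\<lambda>i. V $$ (i, a))))) = (\<Sum>a<n. eta (\<Sum>b<n. ?p a b * l b))"
    by (simp add: spectral_decomp_qform[OF s] mult.commute del: of_real_sum)
  also have "\<dots> \<le> (\<Sum>a<n. \<Sum>b<n. ?p a b * eta (l b))"
    by (intro sum_mono eta_jensen) (use l unitary_entries(2)[OF U V] in auto)
  also have "\<dots> = (\<Sum>b<n. (\<Sum>a<n. ?p a b) * eta (l b))"
    by (subst sum.swap) (simp add: sum_distrib_right)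
  also have "\<dots> = (\<Sum>b<n. eta (l b))"
    by (intro sum.cong refl) (simp add: unitary_entries(1)[OF U V])
  also have "\<dots> = - vn_entropy A" using vn_entropy_spectral[OF s] by simp
  finally show ?thesis .
qed

text \<open>The summands are not normalised: for a density operator \<open>T\<close> and \<open>c \<ge> 0\<close> one has
  \<open>vn_entropy (c T) + eta c = c * vn_entropy T\<close>, so this is the usual concavity of the entropy.\<close>

lemma vn_entropy_concave:
  assumes "finite I" and A: "A \<in> carrier_mat n n" and G: "\<And>i. i \<in> I \<Longrightarrow> psd n (G i)"
    and AG: "\<And>x y. x < n \<Longrightarrow> y < n \<Longrightarrow> A $$ (x, y) = (\<Sum>i\<in>I. G i $$ (x, y))"
    and tr: "(\<Sum>i\<in>I. Re (mtrace (G i))) = 1"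
  shows "(\<Sum>i\<in>I. vn_entropy (G i) + eta (Re (mtrace (G i)))) \<le> vn_entropy A"
proof -
  have qA: "qform n A v = (\<Sum>i\<in>I. qform n (G i) v)" for v
  proof -
    have "qform n A v = (\<Sum>x<n. \<Sum>y<n. \<Sum>i\<in>I. cnj (v x) * G i $$ (x, y) * v y)"
      unfolding qform_def by (intro sum.cong refl) (simp add: AG sum_distrib_left sum_distrib_right)
    also have "\<dots> = (\<Sum>i\<in>I. qform n (G i) v)"
      unfolding qform_def by (simp only: sum.swap[where B = I])
    finally show ?thesis .
  qed
  have "psd n A"
    unfolding psd_iff_qform
  proof (intro conjI allI impI)
    show "A $$ (i, j) = cnj (A $$ (j, i))" if "i < n" "j < n" for i j
      unfolding AG[OF that] AG[OF that(2,1)] cnj_sum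
      using G that unfolding psd_def by (intro sum.cong refl) blast
  qed (use A qA G in \<open>auto simp: psd_iff_qform intro!: sum_nonneg\<close>)
  then obtain V m where s: "spectral_decomp n A V m"
    using psd_spectral by blast
  then have V: "V \<in> carrier_mat n n" "dagger V * V = 1\<^sub>m n" by (auto simp: spectral_decomp_def)
  define g where "g i a = Re (qform n (G i) (\<lambda>x. V $$ (x, a)))" for i a
  define q where "q i = Re (mtrace (G i))" for i
  have g0: "0 \<le> g i a" if "i \<in> I" for i a
    using G[OF that] unfolding psd_iff_qform g_def by blast
  have q: "(\<Sum>a<n. g i a) = q i" if "i \<in> I" for i
    unfolding g_def q_def by (rule trace_unitary_basis[OF G[OF that] V])
  have q0: "0 \<le> q i" if "i \<in> I" for i
    unfolding q_def by (rule psd_trace_Re_nonneg(1)[OF G[OF that]])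
  have m: "m a = (\<Sum>i\<in>I. g i a)" if a: "a < n" for a
  proof -
    have "Re (qform n A (\<lambda>x. V $$ (x, a))) = (\<Sum>b<n. m b * (cmod (\<Sum>i<n. cnj (V $$ (i, a)) * V $$ (i, b)))\<^sup>2)"
      by (simp add: spectral_decomp_qform[OF s] del: of_real_sum)
    also have "\<dots> = (\<Sum>b<n. if b = a then m b else 0)"
      using V(2) a unfolding dagger_self_mult_eq_one_iff[OF V(1)]
      by (intro sum.cong refl) auto
    also have "\<dots> = m a" using a by simp
    finally show ?thesis by (simp add: qA g_def)
  qed
  \<comment> \<open>In an eigenbasis of A the log-sum inequality applies entrywise to the diagonals of the summands;
     Peierls' inequality then replaces these diagonals by the spectra.\<close>
  have "- vn_entropy A = (\<Sum>a<n. eta (\<Sum>i\<in>I. g i a))"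
    using vn_entropy_spectral[OF s] by (simp add: m)
  also have "\<dots> \<le> (\<Sum>a<n. \<Sum>i\<in>I. eta (g i a) - g i a * ln (q i))"
  proof (intro sum_mono eta_sum_le)
    \<comment> \<open>The side condition of the log-sum inequality: a trace of zero forces every
      nonnegative diagonal entry to vanish.\<close>
    fix a i assume ai: "a \<in> {..<n}" "i \<in> I" "q i = 0"
    then have "(\<Sum>a<n. g i a) = 0" using q by simp
    then show "g i a = 0"
      using ai g0[OF ai(2)] by (subst (asm) sum_nonneg_eq_0_iff) auto
  qed (use assms(1) g0 q0 tr in \<open>auto simp: q_def\<close>)
  also have "\<dots> = (\<Sum>i\<in>I. (\<Sum>a<n. eta (g i a)) - (\<Sum>a<n. g i a) * ln (q i))"
    by (subst sum.swap) (simp add: sum_subtractf sum_distrib_right)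
  also have "\<dots> \<le> (\<Sum>i\<in>I. - vn_entropy (G i) - eta (q i))"
  proof (intro sum_mono diff_mono)
    fix i assume i: "i \<in> I"
    show "(\<Sum>a<n. eta (g i a)) \<le> - vn_entropy (G i)"
      unfolding g_def by (rule peierls_inequality[OF G[OF i] V])
    show "eta (q i) \<le> (\<Sum>a<n. g i a) * ln (q i)"
      using q[OF i] q0[OF i] by (auto simp: eta_def)
  qed
  finally show ?thesis by (simp add: sum_subtractf sum_negf sum.distrib q_def)
qed

section \<open>Block matrices and channels\<close>

lemma psd_carrier: "psd n A \<Longrightarrow> A \<in> carrier_mat n n"
  unfolding psd_def by blast

lemma densityD:
  assumes "density n A"
  shows "psd n A" "A \<in> carrier_mat n n" "mtrace A = 1"
  using assms psd_carrier unfolding density_def by blast+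

lemma pair_index_less:
  fixes i d a k :: nat
  assumes "i < d" "a < k"
  shows "i * k + a < d * k"
proof -
  have "i * k + a < Suc i * k" using assms(2) by simp
  also have "\<dots> \<le> d * k" using assms(1) by (intro mult_le_mono1) simp
  finally show ?thesis .
qed

lemma sum_pair_index:
  fixes f :: "nat \<Rightarrow> 'a::comm_monoid_add"
  shows "(\<Sum>r<d * k. f r) = (\<Sum>i<d. \<Sum>a<k. f (i * k + a))"
proof -
  have "(\<Sum>a<k. f (i * k + a)) = sum f {i * k..<i * k + k}" for i
    using sum.shift_bounds_nat_ivl[of f 0 "i * k" k] by (simp add: atLeast0LessThan add.commute)
  then show ?thesis by (simp add: sum.nat_group)
qed

text \<open>The operator \<open><i|X|j>\<close> on the second factor, in the index convention
  \<open>(x, a) \<mapsto> x * k + a\<close> of the tensor product.\<close>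

definition block :: "nat \<Rightarrow> complex mat \<Rightarrow> nat \<Rightarrow> nat \<Rightarrow> complex mat" where
  "block k X i j = mat k k (\<lambda>(a, b). X $$ (i * k + a, j * k + b))"

lemma block_carrier [simp]: "block k X i j \<in> carrier_mat k k"
  by (simp add: block_def)

lemma mtrace_blocks:
  assumes "X \<in> carrier_mat (d * k) (d * k)"
  shows "mtrace X = (\<Sum>i<d. mtrace (block k X i i))"
  using assms by (simp add: mtrace_def block_def sum_pair_index)

lemma mtrace_mult_commute:
  assumes "A \<in> carrier_mat n m" "B \<in> carrier_mat m n"
  shows "mtrace (A * B) = mtrace (B * A)"
proof -
  have "mtrace (A * B) = (\<Sum>i<n. \<Sum>x<m. A $$ (i, x) * B $$ (x, i))"
    unfolding mtrace_def using assms
    by (auto intro!: sum.cong index_mult_mat_sum simp del: index_mult_mat(1))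
  also have "\<dots> = (\<Sum>x<m. \<Sum>i<n. B $$ (x, i) * A $$ (i, x))"
    by (subst sum.swap) (simp add: mult.commute)
  also have "\<dots> = mtrace (B * A)"
    unfolding mtrace_def using assms
    by (auto intro!: sum.cong index_mult_mat_sum[symmetric] simp del: index_mult_mat(1))
  finally show ?thesis .
qed

text \<open>The summand of block \<open>i\<close> equals its trace times the entropy of the
  normalised block. The Shannon entropy of the traces, which a block diagonal \<open>B\<close> would
  contribute as well, can be lost through off-diagonal blocks.\<close>

lemma vn_entropy_ge_diagonal_blocks:
  assumes "psd (d * k) B" and "mtrace B = 1"
  shows "(\<Sum>i<d. vn_entropy (block k B i i) + eta (Re (mtrace (block k B i i)))) \<le> vn_entropy B"
proof -
  let ?n = "d * k"
  obtain W where W: "W \<in> carrier_mat ?n ?n" and BW: "B = W * dagger W"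
    using psd_gramE[OF assms(1)] by blast
  have B: "B \<in> carrier_mat ?n ?n" using assms(1) by (rule psd_carrier)
  define R where "R i = mat k ?n (\<lambda>(a, x). W $$ (i * k + a, x))" for i
  have R: "R i \<in> carrier_mat k ?n" for i by (simp add: R_def)
  \<comment> \<open>\<open>G i\<close> shares the nonzero spectrum of block \<open>i\<close>, but
    all \<open>G i\<close> act on one common space, so they can be added.\<close>
  define G where "G i = dagger (R i) * R i" for i
  have blk: "block k B i i = R i * dagger (R i)" if i: "i < d" for i
  proof (rule eq_matI)
    fix a b assume "a < dim_row (R i * dagger (R i))" "b < dim_col (R i * dagger (R i))"
    then have ab: "a < k" "b < k" using R[of i] by auto
    have "B $$ (i * k + a, i * k + b) = (\<Sum>x<?n. W $$ (i * k + a, x) * dagger W $$ (x, i * k + b))"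
      unfolding BW using W pair_index_less[OF i ab(1)] pair_index_less[OF i ab(2)]
      by (intro index_mult_mat_sum) auto
    also have "\<dots> = (\<Sum>x<?n. R i $$ (a, x) * dagger (R i) $$ (x, b))"
      using W pair_index_less[OF i ab(2)] ab by (intro sum.cong refl) (auto simp: R_def)
    also have "\<dots> = (R i * dagger (R i)) $$ (a, b)"
      using R[of i] ab by (intro index_mult_mat_sum[symmetric]) auto
    finally show "block k B i i $$ (a, b) = (R i * dagger (R i)) $$ (a, b)"
      using ab by (simp add: block_def)
  qed (use R[of i] in \<open>auto simp: block_def\<close>)
  have S: "vn_entropy (block k B i i) = vn_entropy (G i)"
    and T: "mtrace (block k B i i) = mtrace (G i)" if "i < d" for i
    unfolding blk[OF that] G_def
    using R[of i] by (auto intro!: vn_entropy_mult_commute[of _ k ?n] mtrace_mult_commute[of _ k ?n])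
  have "(\<Sum>i<d. vn_entropy (G i) + eta (Re (mtrace (G i)))) \<le> vn_entropy (dagger W * W)"
  proof (rule vn_entropy_concave)
    show "psd ?n (G i)" for i
      using psd_mult_dagger[OF dagger_carrier[OF R[of i]]] by (simp add: G_def)
    show "(dagger W * W) $$ (x, y) = (\<Sum>i<d. G i $$ (x, y))" if xy: "x < ?n" "y < ?n" for x y
    proof -
      have "(dagger W * W) $$ (x, y) = (\<Sum>r<?n. cnj (W $$ (r, x)) * W $$ (r, y))"
        using W xy by (subst index_mult_mat_sum[of _ ?n ?n _ ?n]) auto
      also have "\<dots> = (\<Sum>i<d. \<Sum>a<k. cnj (W $$ (i * k + a, x)) * W $$ (i * k + a, y))"
        by (rule sum_pair_index)
      also have "\<dots> = (\<Sum>i<d. G i $$ (x, y))"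
        unfolding G_def
        by (intro sum.cong refl, subst index_mult_mat_sum[OF dagger_carrier[OF R] R xy])
          (use xy in \<open>auto simp: R_def\<close>)
      finally show ?thesis .
    qed
    have "(\<Sum>i<d. Re (mtrace (G i))) = Re (\<Sum>i<d. mtrace (block k B i i))"
      by (simp add: T)
    then show "(\<Sum>i<d. Re (mtrace (G i))) = 1"
      using assms(2) mtrace_blocks[OF B] by (simp del: Re_sum)
  qed (use W in \<open>auto intro: mult_carrier_mat\<close>)
  also have "\<dots> = vn_entropy B"
    unfolding BW by (rule vn_entropy_mult_commute) (use W in auto)
  finally show ?thesis by (simp add: S T)
qed

lemma psd_gram_funE:
  assumes "psd n A"
  obtains W where "\<And>i j. i < n \<Longrightarrow> j < n \<Longrightarrow> A $$ (i, j) = (\<Sum>x<n. W i x * cnj (W j x))"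
proof -
  obtain W where W: "W \<in> carrier_mat n n" and A: "A = W * dagger W"
    using psd_gramE[OF assms] by blast
  have "A $$ (i, j) = (\<Sum>x<n. W $$ (i, x) * cnj (W $$ (j, x)))" if "i < n" "j < n" for i j
    unfolding A using W that by (subst index_mult_mat_sum[of _ n n _ n]) auto
  then show ?thesis by (rule that)
qed

lemma psd_block:
  assumes "psd (d * k) X" "i < d"
  shows "psd k (block k X i i)"
proof -
  obtain W where W: "\<And>i j. i < d * k \<Longrightarrow> j < d * k \<Longrightarrow> X $$ (i, j) = (\<Sum>x<d * k. W i x * cnj (W j x))"
    using psd_gram_funE[OF assms(1)] by blast
  show ?thesis
    by (rule psd_gramI[where I = "{..<d * k}" and W = "\<lambda>a x. W (i * k + a) x"])
      (auto simp: block_def W pair_index_less[OF assms(2)])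
qed

text \<open>A Gram factorisation of \<open>X\<close> gives one for the reduced operator, with Gram
  vectors indexed by the traced-out index paired with the original one.\<close>

lemma density_ptrace_H:
  assumes "density (d * k) X"
  shows "density k (ptrace_H d k X)"
proof -
  have psd: "psd (d * k) X" and X: "X \<in> carrier_mat (d * k) (d * k)" and tr: "mtrace X = 1"
    using densityD[OF assms] by blast+
  obtain W where W: "\<And>i j. i < d * k \<Longrightarrow> j < d * k \<Longrightarrow> X $$ (i, j) = (\<Sum>x<d * k. W i x * cnj (W j x))"
    using psd_gram_funE[OF psd] by blast
  have "psd k (ptrace_H d k X)"
    by (rule psd_gramI[where I = "{..<d} \<times> {..<d * k}" and W = "\<lambda>a (i, x). W (i * k + a) x"])
      (auto simp: ptrace_H_def W pair_index_less sum.cartesian_product split_def)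
  moreover have "mtrace (ptrace_H d k X) = (\<Sum>i<d. \<Sum>a<k. X $$ (i * k + a, i * k + a))"
    by (subst sum.swap) (simp add: mtrace_def ptrace_H_def)
  moreover have "\<dots> = mtrace X"
    using X by (simp add: mtrace_def sum_pair_index)
  ultimately show ?thesis using tr by (simp add: density_def)
qed

lemma density_ptrace_K:
  assumes "density (d * k) X"
  shows "density d (ptrace_K d k X)"
proof -
  have psd: "psd (d * k) X" and X: "X \<in> carrier_mat (d * k) (d * k)" and tr: "mtrace X = 1"
    using densityD[OF assms] by blast+
  obtain W where W: "\<And>i j. i < d * k \<Longrightarrow> j < d * k \<Longrightarrow> X $$ (i, j) = (\<Sum>x<d * k. W i x * cnj (W j x))"
    using psd_gram_funE[OF psd] by blast
  have "psd d (ptrace_K d k X)"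
    by (rule psd_gramI[where I = "{..<k} \<times> {..<d * k}" and W = "\<lambda>i (a, x). W (i * k + a) x"])
      (auto simp: ptrace_K_def W pair_index_less sum.cartesian_product split_def)
  moreover have "mtrace (ptrace_K d k X) = mtrace X"
    using X by (simp add: mtrace_def ptrace_K_def sum_pair_index)
  ultimately show ?thesis using tr by (simp add: density_def)
qed

section \<open>Linearity and complete positivity of channels\<close>

text \<open>Expansion in matrix units by linearity. \<open>chan_tensor\<close> is defined through
  values on matrix units, and this recovers the image of a whole block.\<close>

lemma channel_entry:
  assumes "channel n m \<Psi>" and A: "A \<in> carrier_mat n n" and rs: "r < m" "s < m"
  shows "\<Psi> A $$ (r, s) = (\<Sum>a<n. \<Sum>b<n. A $$ (a, b) * \<Psi> (mat_unit n a b) $$ (r, s))"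
proof -
  from assms(1) have carr: "\<And>X. X \<in> carrier_mat n n \<Longrightarrow> \<Psi> X \<in> carrier_mat m m"
    and add: "\<And>X Y. X \<in> carrier_mat n n \<Longrightarrow> Y \<in> carrier_mat n n \<Longrightarrow> \<Psi> (X + Y) = \<Psi> X + \<Psi> Y"
    and scale: "\<And>X c. X \<in> carrier_mat n n \<Longrightarrow> \<Psi> (c \<cdot>\<^sub>m X) = c \<cdot>\<^sub>m \<Psi> X"
    unfolding channel_def by blast+
  have mu: "mat_unit n a b \<in> carrier_mat n n" for a b by (simp add: mat_unit_def)
  \<comment> \<open>\<open>P S\<close> keeps the entries of \<open>A\<close> at positions in
    \<open>S\<close>; the induction adds one matrix unit at a time.\<close>
  define P where "P S = mat n n (\<lambda>(a, b). if (a, b) \<in> S then A $$ (a, b) else 0)" for S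
  have Pc: "P S \<in> carrier_mat n n" for S by (simp add: P_def)
  have "\<Psi> (P S) $$ (r, s) = (\<Sum>(a, b)\<in>S. A $$ (a, b) * \<Psi> (mat_unit n a b) $$ (r, s))"
    if "finite S" "S \<subseteq> {..<n} \<times> {..<n}" for S
    using that
  proof (induction S rule: finite_induct)
    case empty
    \<comment> \<open>The zero matrix is written as a multiple of \<open>A\<close>, so that
      homogeneity gives its image.\<close>
    have "P {} = 0 \<cdot>\<^sub>m A" using A by (auto simp: P_def intro!: eq_matI)
    then show ?case using scale[OF A, of 0] carr[OF A] rs by simp
  next
    case (insert z S)
    obtain a b where z: "z = (a, b)" by (cases z)
    have ab: "a < n" "b < n" "(a, b) \<notin> S" using insert z by auto
    have "P (insert z S) = A $$ (a, b) \<cdot>\<^sub>m mat_unit n a b + P S"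
      by (rule eq_matI) (use ab in \<open>auto simp: P_def z mat_unit_def\<close>)
    then have "\<Psi> (P (insert z S)) = A $$ (a, b) \<cdot>\<^sub>m \<Psi> (mat_unit n a b) + \<Psi> (P S)"
      using add[OF smult_carrier_mat[OF mu] Pc] scale[OF mu] by simp
    then show ?case
      using insert z rs carr[OF mu[of a b]] carr[OF Pc[of S]] by simp
  qed
  from this[of "{..<n} \<times> {..<n}"] have "\<Psi> (P ({..<n} \<times> {..<n})) $$ (r, s) =
      (\<Sum>a<n. \<Sum>b<n. A $$ (a, b) * \<Psi> (mat_unit n a b) $$ (r, s))"
    by (simp add: sum.cartesian_product)
  moreover have "P ({..<n} \<times> {..<n}) = A"
    by (rule eq_matI) (use A in \<open>auto simp: P_def\<close>)
  ultimately show ?thesis by simp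
qed

text \<open>Complete positivity with an ancilla of dimension 1, where \<open>id_tensor\<close>
  reduces to the channel itself.\<close>

lemma channel_psd:
  assumes "channel n m \<Psi>" "psd n A"
  shows "psd m (\<Psi> A)"
proof -
  have A: "A \<in> carrier_mat n n" using assms(2) by (rule psd_carrier)
  have \<Psi>A: "\<Psi> A \<in> carrier_mat m m" using assms(1) A unfolding channel_def by blast
  have "psd (1 * m) (id_tensor 1 n m \<Psi> A)"
    using assms unfolding channel_def by (metis mult_1)
  moreover have "mat n n (\<lambda>(a, b). A $$ (a, b)) = A"
    by (rule eq_matI) (use A in auto)
  then have "id_tensor 1 n m \<Psi> A = \<Psi> A"
    by (intro eq_matI) (use \<Psi>A in \<open>auto simp: id_tensor_def\<close>)
  ultimately show ?thesis by simp
qed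

lemma channel_density:
  assumes "channel n m \<Psi>" "density n A"
  shows "density m (\<Psi> A)"
proof -
  have "mtrace (\<Psi> A) = mtrace A"
    using assms(1) densityD(2)[OF assms(2)] unfolding channel_def by blast
  then show ?thesis
    using channel_psd[OF assms(1)] densityD[OF assms(2)] unfolding density_def by simp
qed

lemma block_id_tensor:
  assumes "channel n m \<Psi>" "i < p" "j < p"
  shows "block m (id_tensor p n m \<Psi> X) i j = \<Psi> (block n X i j)"
proof -
  have "\<Psi> (block n X i j) \<in> carrier_mat m m"
    using assms(1) block_carrier unfolding channel_def by blast
  then show ?thesis
    using assms by (intro eq_matI) (auto simp: block_def id_tensor_def pair_index_less)
qed

lemma density_id_tensor:
  assumes "channel n m \<Psi>" "density (p * n) X"
  shows "density (p * m) (id_tensor p n m \<Psi> X)"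
proof -
  have X: "X \<in> carrier_mat (p * n) (p * n)" using densityD(2)[OF assms(2)] .
  have T: "id_tensor p n m \<Psi> X \<in> carrier_mat (p * m) (p * m)" by (simp add: id_tensor_def)
  have "mtrace (id_tensor p n m \<Psi> X) = (\<Sum>i<p. mtrace (\<Psi> (block n X i i)))"
    unfolding mtrace_blocks[OF T] by (simp add: block_id_tensor[OF assms(1)])
  also have "\<dots> = (\<Sum>i<p. mtrace (block n X i i))"
    using assms(1) block_carrier unfolding channel_def by (intro sum.cong refl) blast
  also have "\<dots> = mtrace X" by (rule mtrace_blocks[OF X, symmetric])
  finally have "mtrace (id_tensor p n m \<Psi> X) = 1" using densityD(3)[OF assms(2)] by simp
  \<comment> \<open>Complete positivity, with a reference system of dimension
    \<open>p\<close>.\<close>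
  moreover have "psd (p * m) (id_tensor p n m \<Psi> X)"
    using assms(1) densityD(1)[OF assms(2)] unfolding channel_def by blast
  ultimately show ?thesis by (simp add: density_def)
qed

text \<open>Any finite index set is allowed, since refined decompositions are indexed by pairs.
  Nonnegative output entropies make the set of averages bounded below; only then does
  \<open>Inf\<close> bound its members.\<close>

lemma H_chan_le:
  fixes \<pi> :: "'a \<Rightarrow> real"
  assumes nonneg: "\<And>T. density n T \<Longrightarrow> 0 \<le> vn_entropy (\<Psi> T)"
    and "finite I" and \<pi>: "\<And>x. x \<in> I \<Longrightarrow> 0 \<le> \<pi> x" and \<tau>: "\<And>x. x \<in> I \<Longrightarrow> density n (\<tau> x)"
    and "(\<Sum>x\<in>I. \<pi> x) = 1"
    and "\<And>a b. a < n \<Longrightarrow> b < n \<Longrightarrow> \<sigma> $$ (a, b) = (\<Sum>x\<in>I. of_real (\<pi> x) * \<tau> x $$ (a, b))"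
  shows "H_chan n \<Psi> \<sigma> \<le> (\<Sum>x\<in>I. \<pi> x * vn_entropy (\<Psi> (\<tau> x)))"
proof -
  obtain h where "bij_betw h {0..<card I} I"
    using ex_bij_betw_nat_finite[OF assms(2)] by blast
  then have h: "bij_betw h {..<card I} I" by (simp add: atLeast0LessThan)
  have hI: "h j \<in> I" if "j < card I" for j
    using h that by (auto simp: bij_betw_def)
  note re = sum.reindex_bij_betw[OF h, symmetric]
  show ?thesis
    unfolding H_chan_def
  proof (rule cInf_lower, goal_cases)
    case 1
    show ?case
      unfolding mem_Collect_eq
      by (intro exI[of _ "card I"] exI[of _ "\<lambda>j. \<pi> (h j)"] exI[of _ "\<lambda>j. \<tau> (h j)"])
        (use assms hI in \<open>auto simp: re\<close>)
  next
    case 2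
    show ?case
      by (rule bdd_belowI[of _ 0]) (auto intro!: sum_nonneg mult_nonneg_nonneg nonneg)
  qed
qed

section \<open>The erasure channel\<close>

text \<open>\<open>\<omega>\<close> is the last basis vector up to a phase, and the phase drops out
  of its projector.\<close>

lemma orthogonal_unit_vec_last:
  fixes \<omega> :: "complex vec"
  assumes "\<forall>i<d. \<omega> $ i = 0" and "(\<Sum>i<Suc d. (cmod (\<omega> $ i))\<^sup>2) = 1"
  shows "\<omega> $ d * cnj (\<omega> $ d) = 1"
proof -
  have "(cmod (\<omega> $ d))\<^sup>2 = 1" using assms by simp
  then show ?thesis by (simp only: complex_norm_square[symmetric] of_real_1)
qed

lemma erasure_four_block:
  assumes "\<forall>i<d. \<omega> $ i = 0" and "(\<Sum>i<Suc d. (cmod (\<omega> $ i))\<^sup>2) = 1"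
    and "\<sigma> \<in> carrier_mat d d"
  shows "erasure d \<epsilon> \<omega> \<sigma> = four_block_mat (of_real (1 - \<epsilon>) \<cdot>\<^sub>m \<sigma>) (0\<^sub>m d 1) (0\<^sub>m 1 d)
    (mat 1 1 (\<lambda>_. of_real \<epsilon> * mtrace \<sigma>))"
  using assms orthogonal_unit_vec_last[OF assms(1,2)]
  by (intro eq_matI) (auto simp: erasure_def mult.assoc less_Suc_eq)

text \<open>The signal and the erasure flag occupy orthogonal blocks of traces
  \<open>1 - \<epsilon>\<close> and \<open>\<epsilon>\<close>; scaling \<open>\<sigma>\<close>
  produces \<open>eta (1 - \<epsilon>)\<close> and the flag block produces
  \<open>eta \<epsilon>\<close>.\<close>

lemma vn_entropy_erasure:
  assumes "\<forall>i<d. \<omega> $ i = 0" and "(\<Sum>i<Suc d. (cmod (\<omega> $ i))\<^sup>2) = 1"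
    and "\<epsilon> \<le> 1" and "density d \<sigma>"
  shows "vn_entropy (erasure d \<epsilon> \<omega> \<sigma>) = - eta \<epsilon> - eta (1 - \<epsilon>) + (1 - \<epsilon>) * vn_entropy \<sigma>"
proof -
  note \<sigma> = densityD[OF assms(4)]
  show ?thesis
    unfolding erasure_four_block[OF assms(1,2) \<sigma>(2)]
    using vn_entropy_smult[OF \<sigma>(1), of "1 - \<epsilon>"] assms(3) \<sigma>
    by (subst vn_entropy_four_block_diag[of _ d _ 1]) (simp_all add: vn_entropy_1x1[simplified])
qed

text \<open>Decompose \<open>\<sigma>\<close> along its eigenvectors into pure states. All of them
  have the same output entropy, which is therefore also the average.\<close>

lemma H_chan_erasure_le:
  assumes \<omega>: "\<forall>i<d. \<omega> $ i = 0" "(\<Sum>i<Suc d. (cmod (\<omega> $ i))\<^sup>2) = 1"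
    and \<epsilon>: "0 \<le> \<epsilon>" "\<epsilon> \<le> 1" and \<sigma>: "density d \<sigma>"
  shows "H_chan d (erasure d \<epsilon> \<omega>) \<sigma> \<le> - eta \<epsilon> - eta (1 - \<epsilon>)"
proof -
  obtain U l where s: "spectral_decomp d \<sigma> U l" and l: "\<And>i. i < d \<Longrightarrow> 0 \<le> l i"
    using psd_spectral[OF densityD(1)[OF \<sigma>]] by blast
  then have U: "U \<in> carrier_mat d d" by (auto simp: spectral_decomp_def)
  have \<sigma>U: "\<sigma> $$ (i, j) = (\<Sum>x<d. of_real (l x) * U $$ (i, x) * cnj (U $$ (j, x)))" if "i < d" "j < d" for i j
    using s that unfolding spectral_decomp_iff[OF densityD(2)[OF \<sigma>] U] by blast
  have UU: "(\<Sum>i<d. cnj (U $$ (i, a)) * U $$ (i, a)) = 1" if "a < d" for a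
    using s that unfolding spectral_decomp_iff[OF densityD(2)[OF \<sigma>] U] dagger_self_mult_eq_one_iff[OF U] by simp
  have l1: "(\<Sum>x<d. l x) = 1"
    using spectral_decomp_trace[OF s] densityD(3)[OF \<sigma>] by (simp flip: of_real_sum)
  \<comment> \<open>Eigenvector \<open>x\<close> as a one-column matrix. Exchanging the factors of
    \<open>C x * dagger (C x)\<close> leaves the 1 x 1 matrix with entry 1, so the trace is 1 and
    the entropy 0.\<close>
  define C where "C x = mat d 1 (\<lambda>(i, _). U $$ (i, x))" for x
  define P where "P x = C x * dagger (C x)" for x
  have C: "C x \<in> carrier_mat d 1" for x by (simp add: C_def)
  have P: "P x $$ (i, j) = U $$ (i, x) * cnj (U $$ (j, x))" if "i < d" "j < d" for x i j
    unfolding P_def using that C[of x]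
    by (subst index_mult_mat_sum[of _ d 1 _ d]) (auto simp: C_def)
  have CC: "dagger (C x) * C x = mat 1 1 (\<lambda>_. 1)" if "x < d" for x
  proof (rule eq_matI)
    fix i j assume "i < dim_row (mat 1 1 (\<lambda>_. 1 :: complex))" "j < dim_col (mat 1 1 (\<lambda>_. 1 :: complex))"
    then show "(dagger (C x) * C x) $$ (i, j) = mat 1 1 (\<lambda>_. 1) $$ (i, j)"
      using C[of x] UU[OF that]
      by (subst index_mult_mat_sum[of _ 1 d _ 1]) (auto simp: C_def)
  qed (use C[of x] in auto)
  have dP: "density d (P x)" and SP: "vn_entropy (P x) = 0" if x: "x < d" for x
  proof -
    have "mtrace (P x) = mtrace (dagger (C x) * C x)"
      unfolding P_def by (rule mtrace_mult_commute[of _ d 1]) (use C in auto)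
    then have "mtrace (P x) = 1" by (simp add: CC[OF x] mtrace_def)
    then show "density d (P x)"
      unfolding density_def P_def using psd_mult_dagger[OF C] by simp
    have "vn_entropy (P x) = vn_entropy (dagger (C x) * C x)"
      unfolding P_def by (rule vn_entropy_mult_commute[of _ d 1]) (use C in auto)
    then show "vn_entropy (P x) = 0" by (simp only: CC[OF x] vn_entropy_1x1) simp
  qed
  have "H_chan d (erasure d \<epsilon> \<omega>) \<sigma> \<le> (\<Sum>x<d. l x * vn_entropy (erasure d \<epsilon> \<omega> (P x)))"
  proof (rule H_chan_le)
    show "0 \<le> vn_entropy (erasure d \<epsilon> \<omega> T)" if "density d T" for T
      unfolding vn_entropy_erasure[OF \<omega> \<epsilon>(2) that]
      using vn_entropy_density_nonneg[OF that] eta_nonpos[of \<epsilon>] eta_nonpos[of "1 - \<epsilon>"] \<epsilon> by simp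
  qed (use l l1 dP \<sigma>U P in \<open>auto simp: mult.assoc\<close>)
  also have "\<dots> = (\<Sum>x<d. l x * (- eta \<epsilon> - eta (1 - \<epsilon>)))"
    by (intro sum.cong refl) (simp add: vn_entropy_erasure[OF \<omega> \<epsilon>(2) dP] SP)
  also have "\<dots> = - eta \<epsilon> - eta (1 - \<epsilon>)"
    by (simp only: sum_distrib_right[symmetric] l1 mult_1)
  finally show ?thesis .
qed

section \<open>The erasure channel tensored with a second channel\<close>

text \<open>Erasure multiplies the matrix unit \<open>(i, j)\<close> by
  \<open>1 - \<epsilon>\<close> and adds, only for \<open>i = j\<close>, the flag with weight
  \<open>\<epsilon>\<close>. Hence the flag block collects the diagonal blocks of \<open>X\<close>,
  whose sum is the partial trace, and no entries link flag and signal.\<close>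

lemma chan_tensor_erasure_entry:
  assumes \<omega>: "\<forall>i<d. \<omega> $ i = 0" "(\<Sum>i<Suc d. (cmod (\<omega> $ i))\<^sup>2) = 1"
    and "channel k k \<Omega>" and pq: "p < Suc d" "q < Suc d" and ab: "a < k" "b < k"
  shows "chan_tensor d (Suc d) k k (erasure d \<epsilon> \<omega>) \<Omega> X $$ (p * k + a, q * k + b) =
    (if p < d \<and> q < d then of_real (1 - \<epsilon>) * \<Omega> (block k X p q) $$ (a, b)
     else if p = d \<and> q = d then of_real \<epsilon> * \<Omega> (ptrace_H d k X) $$ (a, b) else 0)"
proof -
  define c where "c i j = erasure d \<epsilon> \<omega> (mat_unit d i j) $$ (p, q)" for i j
  have c: "c i j = (if p < d \<and> q < d then (if i = p \<and> j = q then of_real (1 - \<epsilon>) else 0)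
      else if p = d \<and> q = d then (if i = j then of_real \<epsilon> else 0) else 0)" if "i < d" "j < d" for i j
  proof -
    have "mtrace (mat_unit d i j) = (if i = j then 1 else 0)"
      using that by (auto simp: mtrace_def mat_unit_def if_distrib if_distribR cong: if_cong)
    then show ?thesis
      using pq \<omega>(1) orthogonal_unit_vec_last[OF \<omega>]
      by (auto simp: c_def erasure_def mat_unit_def less_Suc_eq mult.assoc)
  qed
  have row: "p * k + a < Suc d * k" "q * k + b < Suc d * k"
    using pair_index_less[OF pq(1) ab(1)] pair_index_less[OF pq(2) ab(2)] by auto
  have \<Omega>: "(\<Sum>x<k. \<Sum>y<k. A $$ (x, y) * \<Omega> (mat_unit k x y) $$ (a, b)) = \<Omega> A $$ (a, b)"
    if "A \<in> carrier_mat k k" for A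
    using channel_entry[OF assms(3) that ab] by simp
  have "chan_tensor d (Suc d) k k (erasure d \<epsilon> \<omega>) \<Omega> X $$ (p * k + a, q * k + b) =
      (\<Sum>i<d. \<Sum>j<d. \<Sum>x<k. \<Sum>y<k. X $$ (i * k + x, j * k + y) * c i j * \<Omega> (mat_unit k x y) $$ (a, b))"
    unfolding chan_tensor_def c_def using row ab by simp
  also have "\<dots> = (\<Sum>i<d. \<Sum>j<d. c i j * (\<Sum>x<k. \<Sum>y<k. block k X i j $$ (x, y) * \<Omega> (mat_unit k x y) $$ (a, b)))"
    by (simp add: sum_distrib_left block_def mult_ac)
  also have "\<dots> = (\<Sum>i<d. \<Sum>j<d. c i j * \<Omega> (block k X i j) $$ (a, b))"
    by (simp add: \<Omega>)
  finally have main: "chan_tensor d (Suc d) k k (erasure d \<epsilon> \<omega>) \<Omega> X $$ (p * k + a, q * k + b) =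
      (\<Sum>i<d. \<Sum>j<d. c i j * \<Omega> (block k X i j) $$ (a, b))" .
  consider "p < d" "q < d" | "p = d" "q = d" | "p < d" "q = d" | "p = d" "q < d"
    using pq by linarith
  then show ?thesis
  proof cases
    case 1
    have "(\<Sum>i<d. \<Sum>j<d. c i j * \<Omega> (block k X i j) $$ (a, b)) =
        (\<Sum>i<d. \<Sum>j<d. if j = q then (if i = p then of_real (1 - \<epsilon>) * \<Omega> (block k X i j) $$ (a, b) else 0) else 0)"
      by (intro sum.cong refl) (use 1 in \<open>auto simp: c\<close>)
    also have "\<dots> = of_real (1 - \<epsilon>) * \<Omega> (block k X p q) $$ (a, b)"
      using 1 by simp
    finally show ?thesis using 1 main by simp
  next
    case 2
    have "(\<Sum>i<d. \<Sum>j<d. c i j * \<Omega> (block k X i j) $$ (a, b)) =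
        (\<Sum>i<d. \<Sum>j<d. if j = i then of_real \<epsilon> * \<Omega> (block k X i j) $$ (a, b) else 0)"
      by (intro sum.cong refl) (use 2 in \<open>auto simp: c\<close>)
    also have "\<dots> = of_real \<epsilon> * (\<Sum>i<d. \<Omega> (block k X i i) $$ (a, b))"
      by (simp add: sum_distrib_left)
    \<comment> \<open>Linearity of \<open>\<Omega>\<close> in coordinates: the images of the
      diagonal blocks sum to the image of the partial trace.\<close>
    also have "(\<Sum>i<d. \<Omega> (block k X i i) $$ (a, b)) =
        (\<Sum>i<d. \<Sum>x<k. \<Sum>y<k. block k X i i $$ (x, y) * \<Omega> (mat_unit k x y) $$ (a, b))"
      by (simp add: \<Omega>)
    also have "\<dots> = (\<Sum>x<k. \<Sum>y<k. \<Sum>i<d. block k X i i $$ (x, y) * \<Omega> (mat_unit k x y) $$ (a, b))"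
      by (simp only: sum.swap[of _ _ "{..<d}"])
    also have "\<dots> = (\<Sum>x<k. \<Sum>y<k. ptrace_H d k X $$ (x, y) * \<Omega> (mat_unit k x y) $$ (a, b))"
      by (intro sum.cong refl) (simp add: ptrace_H_def block_def sum_distrib_right)
    also have "\<dots> = \<Omega> (ptrace_H d k X) $$ (a, b)"
      by (rule \<Omega>) (simp add: ptrace_H_def)
    finally show ?thesis using 2 main by simp
  qed (use main in \<open>simp_all add: c\<close>)
qed

text \<open>The composite index convention puts the flag into the last \<open>k\<close> rows and
  columns, so the \<open>d + 1\<close> by \<open>d + 1\<close> array of blocks regroups into a two
  by two one.\<close>

lemma chan_tensor_erasure_four_block:
  assumes \<omega>: "\<forall>i<d. \<omega> $ i = 0" "(\<Sum>i<Suc d. (cmod (\<omega> $ i))\<^sup>2) = 1"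
    and \<Omega>: "channel k k \<Omega>"
  shows "chan_tensor d (Suc d) k k (erasure d \<epsilon> \<omega>) \<Omega> X =
    four_block_mat (of_real (1 - \<epsilon>) \<cdot>\<^sub>m id_tensor d k k \<Omega> X) (0\<^sub>m (d * k) k) (0\<^sub>m k (d * k))
      (of_real \<epsilon> \<cdot>\<^sub>m \<Omega> (ptrace_H d k X))" (is "?L = ?R")
proof (rule eq_matI)
  have T: "id_tensor d k k \<Omega> X \<in> carrier_mat (d * k) (d * k)" by (simp add: id_tensor_def)
  have "ptrace_H d k X \<in> carrier_mat k k" by (simp add: ptrace_H_def)
  then have H: "\<Omega> (ptrace_H d k X) \<in> carrier_mat k k" using \<Omega> unfolding channel_def by blast
  show "dim_row ?L = dim_row ?R" "dim_col ?L = dim_col ?R"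
    using T H by (auto simp: chan_tensor_def)
  fix r s assume "r < dim_row ?R" "s < dim_col ?R"
  then have rs: "r < Suc d * k" "s < Suc d * k" using T H by auto
  then have k: "0 < k" by (cases k) auto
  have div: "r div k < Suc d" "s div k < Suc d"
    using rs by (auto simp: less_mult_imp_div_less)
  have lt: "x div k < d \<longleftrightarrow> x < d * k" for x
    using k by (simp add: div_less_iff_less_mult)
  \<comment> \<open>In the flag block the remainder modulo \<open>k\<close> is the offset from
    \<open>d * k\<close>, which is how \<open>four_block_mat\<close> indexes its lower right
    block.\<close>
  have last: "x mod k = x - d * k" if "x < Suc d * k" "\<not> x < d * k" for x
    using that by (metis add_diff_cancel_left' less_Suc_eq less_mult_imp_div_less lt minus_div_mult_eq_mod mult.commute)
  have "?L $$ (r, s) = ?L $$ (r div k * k + r mod k, s div k * k + s mod k)" by simp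
  also have "\<dots> = (if r div k < d \<and> s div k < d
      then of_real (1 - \<epsilon>) * \<Omega> (block k X (r div k) (s div k)) $$ (r mod k, s mod k)
      else if r div k = d \<and> s div k = d then of_real \<epsilon> * \<Omega> (ptrace_H d k X) $$ (r mod k, s mod k) else 0)"
    by (rule chan_tensor_erasure_entry[OF \<omega> \<Omega> div]) (use k in auto)
  also have "\<dots> = ?R $$ (r, s)"
  proof -
    have "r div k = d \<longleftrightarrow> \<not> r < d * k" "s div k = d \<longleftrightarrow> \<not> s < d * k"
      using div lt[of r] lt[of s] by linarith+
    moreover have "r - d * k < k" if "\<not> r < d * k" using rs that by simp
    moreover have "s - d * k < k" if "\<not> s < d * k" using rs that by simp
    ultimately show ?thesis
      using rs T H lt[of r] lt[of s] last[OF rs(1)] last[OF rs(2)]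
      by (auto simp: id_tensor_def block_def)
  qed
  finally show "?L $$ (r, s) = ?R $$ (r, s)" .
qed

lemma vn_entropy_chan_tensor_erasure:
  assumes \<omega>: "\<forall>i<d. \<omega> $ i = 0" "(\<Sum>i<Suc d. (cmod (\<omega> $ i))\<^sup>2) = 1"
    and \<epsilon>: "0 \<le> \<epsilon>" "\<epsilon> \<le> 1" and \<Omega>: "channel k k \<Omega>" and X: "density (d * k) X"
  shows "vn_entropy (chan_tensor d (Suc d) k k (erasure d \<epsilon> \<omega>) \<Omega> X) =
    - eta \<epsilon> - eta (1 - \<epsilon>) + \<epsilon> * vn_entropy (\<Omega> (ptrace_H d k X)) + (1 - \<epsilon>) * vn_entropy (id_tensor d k k \<Omega> X)"
proof -
  note T = densityD[OF density_id_tensor[OF \<Omega> X]]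
  note H = densityD[OF channel_density[OF \<Omega> density_ptrace_H[OF X]]]
  show ?thesis
    unfolding chan_tensor_erasure_four_block[OF \<omega> \<Omega>]
    using vn_entropy_smult[OF T(1), of "1 - \<epsilon>"] vn_entropy_smult[OF H(1), of \<epsilon>] \<epsilon> T H
    by (subst vn_entropy_four_block_diag[of _ "d * k" _ k]) simp_all
qed

section \<open>Comparison of decompositions and superadditivity\<close>

text \<open>The normalised diagonal blocks of \<open>X\<close>, weighted by their traces, sum to the
  partial trace over the first factor; so \<open>q\<close> and \<open>\<tau>\<close> provide a
  decomposition of an input of \<open>\<Omega>\<close>.\<close>

lemma vn_entropy_id_tensor_ge:
  assumes \<Omega>: "channel n m \<Omega>" and X: "density (d * n) X"
  obtains q \<tau> where "\<And>i. i < d \<Longrightarrow> 0 \<le> q i" "\<And>i. i < d \<Longrightarrow> density n (\<tau> i)"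
    "(\<Sum>i<d. q i) = (1::real)" "\<And>i. i < d \<Longrightarrow> block n X i i = of_real (q i) \<cdot>\<^sub>m \<tau> i"
    "(\<Sum>i<d. q i * vn_entropy (\<Omega> (\<tau> i))) \<le> vn_entropy (id_tensor d n m \<Omega> X)"
proof -
  \<comment> \<open>An empty matrix has trace 0, so a density operator forces positive dimensions;
    blocks of trace zero can then still be assigned a density operator.\<close>
  have "d * n \<noteq> 0"
  proof
    assume "d * n = 0"
    then have "dim_row X = 0" using densityD(2)[OF X] by auto
    then show False using densityD(3)[OF X] by (simp add: mtrace_def)
  qed
  then have n: "0 < n" by simp
  define q where "q i = Re (mtrace (block n X i i))" for i
  have "\<exists>T. density n T \<and> block n X i i = of_real (q i) \<cdot>\<^sub>m T" if "i < d" for i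
    using psd_eq_smult_density[OF psd_block[OF densityD(1)[OF X] that] n] unfolding q_def by blast
  then obtain \<tau> where \<tau>: "\<And>i. i < d \<Longrightarrow> density n (\<tau> i)"
    and bl: "\<And>i. i < d \<Longrightarrow> block n X i i = of_real (q i) \<cdot>\<^sub>m \<tau> i" by metis
  have q0: "0 \<le> q i" if "i < d" for i
    unfolding q_def by (rule psd_trace_Re_nonneg(1)[OF psd_block[OF densityD(1)[OF X] that]])
  have q1: "(\<Sum>i<d. q i) = 1"
    using mtrace_blocks[OF densityD(2)[OF X]] densityD(3)[OF X]
    by (simp add: q_def flip: Re_sum)
  note T = densityD[OF density_id_tensor[OF \<Omega> X]]
  \<comment> \<open>\<open>\<Omega>\<close> commutes with the weight and preserves the trace, so the
    term \<open>eta (q i)\<close> cancels the one that comes from rescaling.\<close>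
  have "vn_entropy (block m (id_tensor d n m \<Omega> X) i i) + eta (Re (mtrace (block m (id_tensor d n m \<Omega> X) i i))) =
      q i * vn_entropy (\<Omega> (\<tau> i))" if i: "i < d" for i
  proof -
    have "block m (id_tensor d n m \<Omega> X) i i = \<Omega> (of_real (q i) \<cdot>\<^sub>m \<tau> i)"
      by (simp add: block_id_tensor[OF \<Omega> i i] bl[OF i])
    also have "\<dots> = of_real (q i) \<cdot>\<^sub>m \<Omega> (\<tau> i)"
      using \<Omega> densityD(2)[OF \<tau>[OF i]] unfolding channel_def by blast
    finally have eq: "block m (id_tensor d n m \<Omega> X) i i = of_real (q i) \<cdot>\<^sub>m \<Omega> (\<tau> i)" .
    note D = densityD[OF channel_density[OF \<Omega> \<tau>[OF i]]]
    show ?thesis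
      unfolding eq vn_entropy_smult[OF D(1) q0[OF i]] mtrace_smult[OF D(2)] by (simp add: D(3))
  qed
  then have "(\<Sum>i<d. q i * vn_entropy (\<Omega> (\<tau> i))) \<le> vn_entropy (id_tensor d n m \<Omega> X)"
    using vn_entropy_ge_diagonal_blocks[OF T(1,3)] by simp
  with q0 \<tau> q1 bl show ?thesis by (rule that)
qed

theorem theorem6:
  fixes d k :: nat and \<epsilon> :: real and \<omega> :: "complex vec"
    and \<Omega> :: "complex mat \<Rightarrow> complex mat" and \<rho> :: "complex mat"
  assumes "\<omega> \<in> carrier_vec (Suc d)"
    and "\<forall>i<d. \<omega> $ i = 0"
    and "(\<Sum>i<Suc d. (cmod (\<omega> $ i))\<^sup>2) = 1"
    and "0 \<le> \<epsilon>" and "\<epsilon> \<le> 1"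
    and "channel k k \<Omega>"
    and "density (d * k) \<rho>"
  shows "H_chan (d * k) (chan_tensor d (Suc d) k k (erasure d \<epsilon> \<omega>) \<Omega>) \<rho>
         \<ge> H_chan d (erasure d \<epsilon> \<omega>) (ptrace_K d k \<rho>) + H_chan k \<Omega> (ptrace_H d k \<rho>)"
proof -
  note \<omega> = assms(2,3) and \<epsilon> = assms(4,5) and \<Omega> = assms(6) and \<rho> = assms(7)
  let ?\<Psi> = "chan_tensor d (Suc d) k k (erasure d \<epsilon> \<omega>) \<Omega>"
  let ?h = "- eta \<epsilon> - eta (1 - \<epsilon>)"
  let ?H = "H_chan k \<Omega> (ptrace_H d k \<rho>)"
  have nonneg: "0 \<le> vn_entropy (\<Omega> T)" if "density k T" for T
    by (rule vn_entropy_density_nonneg[OF channel_density[OF \<Omega> that]])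
  \<comment> \<open>The bound for one arbitrary decomposition of \<open>\<rho>\<close>; passing to
    the infimum comes last.\<close>
  have step: "?h + ?H \<le> (\<Sum>j<N. \<pi> j * vn_entropy (?\<Psi> (\<sigma> j)))"
    if \<pi>: "\<And>j. j < N \<Longrightarrow> 0 \<le> \<pi> j" and \<sigma>: "\<And>j. j < N \<Longrightarrow> density (d * k) (\<sigma> j)"
      and \<pi>1: "(\<Sum>j<N. \<pi> j) = 1"
      and dec: "\<And>a b. a < d * k \<Longrightarrow> b < d * k \<Longrightarrow>
        \<rho> $$ (a, b) = (\<Sum>j<N. complex_of_real (\<pi> j) * \<sigma> j $$ (a, b))"
    for N :: nat and \<pi> \<sigma>
  proof -
    have \<rho>H: "ptrace_H d k \<rho> $$ (a, b) = (\<Sum>j<N. of_real (\<pi> j) * (\<Sum>i<d. block k (\<sigma> j) i i $$ (a, b)))"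
      if "a < k" "b < k" for a b
    proof -
      have "ptrace_H d k \<rho> $$ (a, b) = (\<Sum>i<d. \<Sum>j<N. of_real (\<pi> j) * \<sigma> j $$ (i * k + a, i * k + b))"
        using that by (simp add: ptrace_H_def dec pair_index_less)
      also have "\<dots> = (\<Sum>j<N. of_real (\<pi> j) * (\<Sum>i<d. block k (\<sigma> j) i i $$ (a, b)))"
        using that by (subst sum.swap) (simp add: sum_distrib_left block_def)
      finally show ?thesis .
    qed
    \<comment> \<open>Erased branch: the reduced operators of the \<open>\<sigma> j\<close>
      decompose the reduced operator of \<open>\<rho>\<close>.\<close>
    have 1: "?H \<le> (\<Sum>j<N. \<pi> j * vn_entropy (\<Omega> (ptrace_H d k (\<sigma> j))))"
    proof (rule H_chan_le[OF nonneg])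
      show "ptrace_H d k \<rho> $$ (a, b) = (\<Sum>j<N. of_real (\<pi> j) * ptrace_H d k (\<sigma> j) $$ (a, b))"
        if "a < k" "b < k" for a b
        using that by (simp add: \<rho>H) (simp add: ptrace_H_def block_def)
    qed (use \<pi> \<pi>1 density_ptrace_H[OF \<sigma>] in auto)
    \<comment> \<open>\<open>D\<close> bundles the properties of the blocks of one
      \<open>\<sigma> j\<close>, so that weights and states can be chosen for all \<open>j\<close>
      at once.\<close>
    define D where "D j q \<tau> \<longleftrightarrow> (\<forall>i<d. 0 \<le> q i) \<and> (\<forall>i<d. density k (\<tau> i)) \<and> (\<Sum>i<d. q i) = (1::real) \<and>
        (\<forall>i<d. block k (\<sigma> j) i i = of_real (q i) \<cdot>\<^sub>m \<tau> i) \<and>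
        (\<Sum>i<d. q i * vn_entropy (\<Omega> (\<tau> i))) \<le> vn_entropy (id_tensor d k k \<Omega> (\<sigma> j))" for j q \<tau>
    have "\<exists>q \<tau>. D j q \<tau>" if "j < N" for j
      by (rule vn_entropy_id_tensor_ge[OF \<Omega> \<sigma>[OF that]]) (use D_def in blast)
    then obtain q \<tau> where D: "\<And>j. j < N \<Longrightarrow> D j (q j) (\<tau> j)" by metis
    have q: "0 \<le> q j i" and \<tau>: "density k (\<tau> j i)"
      and bl: "block k (\<sigma> j) i i = of_real (q j i) \<cdot>\<^sub>m \<tau> j i" if "j < N" "i < d" for i j
      using D that unfolding D_def by blast+
    have q1: "(\<Sum>i<d. q j i) = 1"
      and ge: "(\<Sum>i<d. q j i * vn_entropy (\<Omega> (\<tau> j i))) \<le> vn_entropy (id_tensor d k k \<Omega> (\<sigma> j))"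
      if "j < N" for j
      using D that unfolding D_def by blast+
    \<comment> \<open>Transmitted branch: the same reduced operator is decomposed into the
      normalised diagonal blocks of all \<open>\<sigma> j\<close>, with weights
      \<open>\<pi> j * q j i\<close>.\<close>
    have "?H \<le> (\<Sum>x\<in>{..<N} \<times> {..<d}. (\<pi> (fst x) * q (fst x) (snd x)) * vn_entropy (\<Omega> (\<tau> (fst x) (snd x))))"
    proof (rule H_chan_le[OF nonneg])
      have "(\<Sum>x\<in>{..<N} \<times> {..<d}. \<pi> (fst x) * q (fst x) (snd x)) = (\<Sum>j<N. \<pi> j * (\<Sum>i<d. q j i))"
        by (simp add: sum.cartesian_product split_def sum_distrib_left)
      also have "\<dots> = 1" using \<pi>1 q1 by simp
      finally show "(\<Sum>x\<in>{..<N} \<times> {..<d}. \<pi> (fst x) * q (fst x) (snd x)) = 1" .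
      show "ptrace_H d k \<rho> $$ (a, b) = (\<Sum>x\<in>{..<N} \<times> {..<d}.
          of_real (\<pi> (fst x) * q (fst x) (snd x)) * \<tau> (fst x) (snd x) $$ (a, b))"
        if ab: "a < k" "b < k" for a b
      proof -
        have entry: "block k (\<sigma> j) i i $$ (a, b) = of_real (q j i) * \<tau> j i $$ (a, b)" if "j < N" "i < d" for i j
          using bl[OF that] densityD(2)[OF \<tau>[OF that]] ab by simp
        have "ptrace_H d k \<rho> $$ (a, b) = (\<Sum>j<N. \<Sum>i<d. of_real (\<pi> j * q j i) * \<tau> j i $$ (a, b))"
          unfolding \<rho>H[OF ab] sum_distrib_left
          by (intro sum.cong refl) (simp add: entry)
        then show ?thesis by (simp add: sum.cartesian_product split_def)
      qed
    qed (use \<pi> q \<tau> in auto)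
    also have "\<dots> = (\<Sum>j<N. \<pi> j * (\<Sum>i<d. q j i * vn_entropy (\<Omega> (\<tau> j i))))"
      by (simp add: sum.cartesian_product split_def sum_distrib_left mult.assoc)
    also have "\<dots> \<le> (\<Sum>j<N. \<pi> j * vn_entropy (id_tensor d k k \<Omega> (\<sigma> j)))"
      by (intro sum_mono mult_left_mono) (use ge \<pi> in auto)
    finally have 2: "?H \<le> (\<Sum>j<N. \<pi> j * vn_entropy (id_tensor d k k \<Omega> (\<sigma> j)))" .
    \<comment> \<open>The same infimum is split with weights \<open>\<epsilon>\<close> and
      \<open>1 - \<epsilon>\<close>, each part being bounded through its own decomposition.\<close>
    have "?h + ?H = ?h + (\<epsilon> * ?H + (1 - \<epsilon>) * ?H)" by (simp add: algebra_simps)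
    also have "\<dots> \<le> ?h + (\<epsilon> * (\<Sum>j<N. \<pi> j * vn_entropy (\<Omega> (ptrace_H d k (\<sigma> j)))) +
        (1 - \<epsilon>) * (\<Sum>j<N. \<pi> j * vn_entropy (id_tensor d k k \<Omega> (\<sigma> j))))"
      using 1 2 \<epsilon> by (intro add_left_mono add_mono mult_left_mono) auto
    also have "\<dots> = ?h * (\<Sum>j<N. \<pi> j) + (\<epsilon> * (\<Sum>j<N. \<pi> j * vn_entropy (\<Omega> (ptrace_H d k (\<sigma> j)))) +
        (1 - \<epsilon>) * (\<Sum>j<N. \<pi> j * vn_entropy (id_tensor d k k \<Omega> (\<sigma> j))))"
      by (simp add: \<pi>1)
    also have "\<dots> = (\<Sum>j<N. \<pi> j * (?h + \<epsilon> * vn_entropy (\<Omega> (ptrace_H d k (\<sigma> j))) +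
        (1 - \<epsilon>) * vn_entropy (id_tensor d k k \<Omega> (\<sigma> j))))"
      unfolding sum_distrib_left sum.distrib[symmetric]
      by (intro sum.cong refl) (simp add: algebra_simps)
    also have "\<dots> = (\<Sum>j<N. \<pi> j * vn_entropy (?\<Psi> (\<sigma> j)))"
      by (intro sum.cong refl) (simp add: vn_entropy_chan_tensor_erasure[OF \<omega> \<epsilon> \<Omega> \<sigma>])
    finally show ?thesis .
  qed
  have "?h + ?H \<le> H_chan (d * k) ?\<Psi> \<rho>"
    unfolding H_chan_def[of "d * k"]
  proof (rule cInf_greatest, goal_cases)
    case 1
    \<comment> \<open>The one-term decomposition shows that the infimum ranges over a nonempty
      set.\<close>
    have "\<exists>(N::nat) \<pi> \<sigma>s. (\<forall>j<N. 0 \<le> \<pi> j \<and> density (d * k) (\<sigma>s j)) \<and> (\<Sum>j<N. \<pi> j) = 1 \<and>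
      (\<forall>a<d * k. \<forall>b<d * k. \<rho> $$ (a, b) = (\<Sum>j<N. complex_of_real (\<pi> j) * \<sigma>s j $$ (a, b)))"
      by (rule exI[of _ 1], rule exI[of _ "\<lambda>_. 1"], rule exI[of _ "\<lambda>_. \<rho>"]) (use \<rho> in simp)
    then show ?case by blast
  next
    case (2 y)
    then obtain N :: nat and \<pi> \<sigma>s where y: "y = (\<Sum>j<N. \<pi> j * vn_entropy (?\<Psi> (\<sigma>s j)))"
      and D: "\<forall>j<N. 0 \<le> \<pi> j \<and> density (d * k) (\<sigma>s j)" "(\<Sum>j<N. \<pi> j) = 1"
        "\<forall>a<d * k. \<forall>b<d * k. \<rho> $$ (a, b) = (\<Sum>j<N. complex_of_real (\<pi> j) * \<sigma>s j $$ (a, b))"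
      by blast
    show ?case unfolding y by (rule step) (use D in blast)+
  qed
  moreover have "H_chan d (erasure d \<epsilon> \<omega>) (ptrace_K d k \<rho>) \<le> ?h"
    by (rule H_chan_erasure_le[OF \<omega> \<epsilon> density_ptrace_K[OF \<rho>]])
  ultimately show ?thesis by linarith
qed

end
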